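(* Let $(R,M)$ be a commutative Noetherian local ring. Every sequentially Cohen--Macaulay finitely generated $R$-module is initially Cohen--Macaulay.
   Context: The initial dimension of an $R$-module $N$ is $\mathrm{indim}\,N=\inf\{\dim R/P\mid P\in\mathrm{Ass}_R N\}$. A finitely generated $R$-module $N$ is initially Cohen--Macaulay if $N=0$ or $\mathrm{depth}\,N=\mathrm{indim}\,N$. Let $N_i$ be the largest submodule of $N$ with $\dim N_i\le i$. $N$ is sequentially Cohen--Macaulay if every quotient $N_i/N_{i-1}$ with $\mathrm{indim}\,N\le i\le\dim N$ is Cohen--Macaulay (the zero module being regarded as Cohen--Macaulay). *)

theory Defs
  imports "HOL-Library.Extended_Real" "HOL-Algebra.Algebra"
begin

locale local_ring = cring R for R (structure) +
  fixes M
  assumes maximal: "maximalideal M R"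
    and maximal_unique: "maximalideal I R \<Longrightarrow> I = M"

definition gen_submodule ::
    "('a, 'r) ring_scheme \<Rightarrow> ('a, 'b, 'm) module_scheme \<Rightarrow> 'b set \<Rightarrow> 'b set"
  where "gen_submodule R N S = \<Inter>{H. submodule H R N \<and> S \<subseteq> H}"

definition fin_gen_module ::
    "('a, 'r) ring_scheme \<Rightarrow> ('a, 'b, 'm) module_scheme \<Rightarrow> bool"
  where "fin_gen_module R N \<longleftrightarrow>
    (\<exists>S \<subseteq> carrier N. finite S \<and> gen_submodule R N S = carrier N)"

definition zero_module :: "('a, 'b, 'm) module_scheme \<Rightarrow> bool"
  where "zero_module N \<longleftrightarrow> carrier N = {\<zero>\<^bsub>N\<^esub>}"

text \<open>A module record also has the multiplicative fields of a ring record; the locale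
  \<^locale>\<open>module\<close> does not constrain them, so they are left undefined here.\<close>

definition quot_module ::
    "('a, 'b, 'm) module_scheme \<Rightarrow> 'b set \<Rightarrow> ('a, 'b set) module"
  where "quot_module N H =
    \<lparr>carrier = a_rcosets\<^bsub>N\<^esub> H, monoid.mult = undefined, one = undefined,
     ring.zero = H, ring.add = set_add N,
     smult = (\<lambda>a C. \<Union>x\<in>C. H +>\<^bsub>N\<^esub> (a \<odot>\<^bsub>N\<^esub> x))\<rparr>"

text \<open>Dimension and depth take values in \<^typ>\<open>ereal\<close>. As \<open>Sup {} = -\<infinity>\<close> and
  \<open>Inf {} = \<infinity>\<close> there, the zero ring and the zero module have dimension \<open>-\<infinity>\<close>, and the
  zero module has initial dimension \<open>\<infinity>\<close>.\<close>

definition krull_dim :: "('a, 'r) ring_scheme \<Rightarrow> ereal"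
  where "krull_dim R =
    Sup {ereal (real n) | n. \<exists>P :: nat \<Rightarrow> 'a set.
      (\<forall>i\<le>n. primeideal (P i) R) \<and> (\<forall>i<n. P i \<subset> P (Suc i))}"

definition annihilator ::
    "('a, 'r) ring_scheme \<Rightarrow> ('a, 'b, 'm) module_scheme \<Rightarrow> 'a set"
  where "annihilator R N = {r \<in> carrier R. \<forall>x\<in>carrier N. r \<odot>\<^bsub>N\<^esub> x = \<zero>\<^bsub>N\<^esub>}"

definition module_dim ::
    "('a, 'r) ring_scheme \<Rightarrow> ('a, 'b, 'm) module_scheme \<Rightarrow> ereal"
  where "module_dim R N = krull_dim (R Quot (annihilator R N))"

definition Ass ::
    "('a, 'r) ring_scheme \<Rightarrow> ('a, 'b, 'm) module_scheme \<Rightarrow> 'a set set"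
  where "Ass R N = {P. primeideal P R \<and>
    (\<exists>x\<in>carrier N. P = {r \<in> carrier R. r \<odot>\<^bsub>N\<^esub> x = \<zero>\<^bsub>N\<^esub>})}"

definition indim ::
    "('a, 'r) ring_scheme \<Rightarrow> ('a, 'b, 'm) module_scheme \<Rightarrow> ereal"
  where "indim R N = (INF P\<in>Ass R N. krull_dim (R Quot P))"

definition nonzerodivisor_on ::
    "('a, 'b, 'm) module_scheme \<Rightarrow> 'a \<Rightarrow> bool"
  where "nonzerodivisor_on N a \<longleftrightarrow>
    (\<forall>x\<in>carrier N. a \<odot>\<^bsub>N\<^esub> x = \<zero>\<^bsub>N\<^esub> \<longrightarrow> x = \<zero>\<^bsub>N\<^esub>)"

text \<open>The submodule \<open>(S)N\<close>, where \<open>(S)\<close> is the ideal generated by \<open>S\<close>.\<close>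

definition ideal_smult ::
    "('a, 'r) ring_scheme \<Rightarrow> ('a, 'b, 'm) module_scheme \<Rightarrow> 'a set \<Rightarrow> 'b set"
  where "ideal_smult R N S = gen_submodule R N {a \<odot>\<^bsub>N\<^esub> x | a x. a \<in> S \<and> x \<in> carrier N}"

definition regular_sequence ::
    "('a, 'r) ring_scheme \<Rightarrow> ('a, 'b, 'm) module_scheme \<Rightarrow> 'a list \<Rightarrow> bool"
  where "regular_sequence R N xs \<longleftrightarrow>
    set xs \<subseteq> carrier R \<and>
    (\<forall>i<length xs. nonzerodivisor_on
       (quot_module N (ideal_smult R N (set (take i xs)))) (xs ! i)) \<and>
    \<not> zero_module (quot_module N (ideal_smult R N (set xs)))"

text \<open>The depth is taken with respect to an ideal \<open>I\<close>; over a local ring, \<open>I\<close> is the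
  maximal ideal. The zero module has depth \<open>\<infinity>\<close>.\<close>

definition depth ::
    "('a, 'r) ring_scheme \<Rightarrow> 'a set \<Rightarrow> ('a, 'b, 'm) module_scheme \<Rightarrow> ereal"
  where "depth R I N =
    (if zero_module N then \<infinity>
     else SUP xs\<in>{xs. set xs \<subseteq> I \<and> regular_sequence R N xs}. ereal (real (length xs)))"

definition cohen_macaulay ::
    "('a, 'r) ring_scheme \<Rightarrow> 'a set \<Rightarrow> ('a, 'b, 'm) module_scheme \<Rightarrow> bool"
  where "cohen_macaulay R M N \<longleftrightarrow> zero_module N \<or> depth R M N = module_dim R N"

definition initially_cohen_macaulay ::
    "('a, 'r) ring_scheme \<Rightarrow> 'a set \<Rightarrow> ('a, 'b, 'm) module_scheme \<Rightarrow> bool"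
  where "initially_cohen_macaulay R M N \<longleftrightarrow> zero_module N \<or> depth R M N = indim R N"

text \<open>The largest submodule, with respect to inclusion, of dimension at most \<open>i\<close>. The
  index is an integer so that \<open>i - 1\<close> makes sense for \<open>i = 0\<close>; for negative \<open>i\<close> this is
  the zero submodule.\<close>

definition dim_filtration ::
    "('a, 'r) ring_scheme \<Rightarrow> ('a, 'b, 'm) module_scheme \<Rightarrow> int \<Rightarrow> 'b set"
  where "dim_filtration R N i =
    (GREATEST H. submodule H R N \<and>
       module_dim R (N\<lparr>carrier := H\<rparr>) \<le> ereal (real_of_int i))"

definition sequentially_cohen_macaulay ::
    "('a, 'r) ring_scheme \<Rightarrow> 'a set \<Rightarrow> ('a, 'b, 'm) module_scheme \<Rightarrow> bool"
  where "sequentially_cohen_macaulay R M N \<longleftrightarrow>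
    (\<forall>i::int. indim R N \<le> ereal (real_of_int i) \<and> ereal (real_of_int i) \<le> module_dim R N \<longrightarrow>
       cohen_macaulay R M
         (quot_module (N\<lparr>carrier := dim_filtration R N i\<rparr>) (dim_filtration R N (i - 1))))"

end

theory Submission
  imports Defs
begin

text \<open>For a nonzero module \<open>N\<close> the inequality \<open>depth N \<le> indim N\<close> needs no hypothesis: if \<open>x\<close> is
  regular on \<open>N\<close> and \<open>P \<in> Ass N\<close>, then some prime in \<open>Ass (N / x N)\<close> contains \<open>P\<close> strictly, so a
  regular sequence produces a chain of primes of the same length starting at \<open>P\<close>. Conversely let
  \<open>d = indim N\<close>, which is finite by Krull's principal ideal theorem. Every nonzero submodule has
  dimension at least \<open>d\<close>, so \<open>N\<^sub>i = 0\<close> for \<open>i < d\<close>; a nonzero quotient \<open>N\<^sub>i / N\<^sub>i\<^sub>-\<^sub>1\<close> has dimension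
  at least \<open>i\<close>, hence, being Cohen--Macaulay, depth at least \<open>d\<close>. Depth at least \<open>d\<close> is inherited
  by extensions, so \<open>depth N \<ge> d\<close>.

  All modules involved are subquotients \<open>A / B\<close> of \<open>N\<close>, represented by pairs of submodules, and
  localization at \<open>P\<close> is replaced by saturation with respect to the complement of \<open>P\<close>.\<close>

section \<open>Submodule calculus\<close>

text \<open>Depth is a supremum over regular sequences, so for an extension both ends must be
  compared along one sequence. In place of cohomology this uses prime avoidance, which yields one
  element of \<open>M\<close> regular on several subquotients at once, and the fact that dividing by
  any regular element lowers a depth bound by at most one, whichever sequence gave the bound.
  Enlarging \<open>B\<close> while \<open>A\<close> stays fixed keeps all quotients inside
  \<open>N\<close>; the elements of a quotient module have type \<open>'b set\<close>, so an
  induction over iterated quotients would change type at every step. A nonzero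
  \<open>N_i / N_(i-1)\<close> has dimension at least \<open>i\<close>: otherwise the product of the
  annihilators of the quotient and of \<open>N_(i-1)\<close> would bound \<open>dim N_i\<close> by
  \<open>i - 1\<close>, which forces \<open>N_i = N_(i-1)\<close>. Finite dimension matters twice:
  the hypothesis speaks only of integers \<open>i\<close> between \<open>indim N\<close> and
  \<open>dim N\<close>, so it would be vacuous for infinite \<open>indim N\<close>, and the ascent
  from \<open>N_(d-1) = 0\<close> ends at \<open>N\<close> only because \<open>dim N\<close> is an
  integer.\<close>

lemma (in noetherian_ring) maximal_ideal_exists:
  assumes "V \<noteq> {}" and I: "\<And>x. x \<in> V \<Longrightarrow> ideal (I x) R"
  shows "\<exists>x\<in>V. \<forall>y\<in>V. I x \<subseteq> I y \<longrightarrow> I y = I x"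
proof -
  have "\<exists>J\<in>I ` V. \<forall>K\<in>I ` V. J \<subseteq> K \<longrightarrow> K = J"
  proof (rule subset_Zorn_nonempty)
    show "I ` V \<noteq> {}" using assms(1) by simp
    fix C assume C: "C \<noteq> {}" "subset.chain (I ` V) C"
    have "subset.chain {I. ideal I R} C"
      using C(2) I by (auto simp: subset.chain_def)
    with C have "\<Union>C \<in> C" by (intro ideal_chain_is_trivial)
    with C(2) show "\<Union>C \<in> I ` V" by (auto simp: subset.chain_def)
  qed
  then show ?thesis by simp
qed

text \<open>The ideal \<open>(B : A)\<close>, which is the annihilator of
  \<open>(A + B) / B\<close>. For \<open>A = {u}\<close> it is the annihilator of the class of
  \<open>u\<close>, so associated primes of subquotients are the primes of this form.\<close>

definition colon ::
    "('a, 'r) ring_scheme \<Rightarrow> ('a, 'b, 'm) module_scheme \<Rightarrow> 'b set \<Rightarrow> 'b set \<Rightarrow> 'a set"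
  where "colon R N B A = {r \<in> carrier R. \<forall>u\<in>A. r \<odot>\<^bsub>N\<^esub> u \<in> B}"

text \<open>For \<open>B\<close> inside \<open>A\<close>, the pair of \<open>A\<close> and
  \<open>x A + B\<close> represents the quotient of \<open>A / B\<close> by
  \<open>x\<close>.\<close>

definition mult_sum :: "('a, 'b, 'm) module_scheme \<Rightarrow> 'a \<Rightarrow> 'b set \<Rightarrow> 'b set \<Rightarrow> 'b set"
  where "mult_sum N x A B = {x \<odot>\<^bsub>N\<^esub> a \<oplus>\<^bsub>N\<^esub> b | a b. a \<in> A \<and> b \<in> B}"

text \<open>For a prime \<open>P\<close>, the preimage in \<open>N\<close> of the localized
  submodule \<open>H_P\<close>. An inclusion of \<open>H\<close> in the saturation of
  \<open>K\<close> therefore says that \<open>H_P\<close> is contained in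
  \<open>K_P\<close>.\<close>

definition saturation ::
    "('a, 'r) ring_scheme \<Rightarrow> ('a, 'b, 'm) module_scheme \<Rightarrow> 'a set \<Rightarrow> 'b set \<Rightarrow> 'b set"
  where "saturation R N P H = {u \<in> carrier N. \<exists>s\<in>carrier R - P. s \<odot>\<^bsub>N\<^esub> u \<in> H}"

definition regular_on :: "('a, 'b, 'm) module_scheme \<Rightarrow> 'a \<Rightarrow> 'b set \<Rightarrow> 'b set \<Rightarrow> bool"
  where "regular_on N x A B \<longleftrightarrow> (\<forall>u\<in>A. x \<odot>\<^bsub>N\<^esub> u \<in> B \<longrightarrow> u \<in> B)"

locale module_over = module R N for R (structure) and N (structure)
begin

abbreviation "sub H \<equiv> submodule H R N"

lemma sub_carrier: "sub H \<Longrightarrow> u \<in> H \<Longrightarrow> u \<in> carrier N"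
  using submoduleE(1) by blast

lemma sub_zero: "sub H \<Longrightarrow> \<zero>\<^bsub>N\<^esub> \<in> H"
  using submoduleE(2)[of H] submoduleE(4)[of H \<zero>] sub_carrier smult_l_null
  by (metis R.zero_closed all_not_in_conv)

lemmas sub_neg = submoduleE(3)
lemmas sub_smult = submoduleE(4)
lemmas sub_add = submoduleE(5)

lemma sub_diff: "sub H \<Longrightarrow> u \<in> H \<Longrightarrow> v \<in> H \<Longrightarrow> u \<ominus>\<^bsub>N\<^esub> v \<in> H"
  by (simp add: M.minus_eq sub_add sub_neg)

lemma sub_add_cancel:
  assumes "sub H" "u \<oplus>\<^bsub>N\<^esub> v \<in> H" "u \<in> carrier N" "v \<in> H"
  shows "u \<in> H"
proof -
  have v: "v \<in> carrier N" using assms sub_carrier by blast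
  have "(u \<oplus>\<^bsub>N\<^esub> v) \<ominus>\<^bsub>N\<^esub> v = u"
    using assms(3) v by (simp add: M.minus_eq M.a_assoc M.r_neg)
  then show ?thesis using sub_diff[OF assms(1,2,4)] by simp
qed

lemma sub_add_cancel':
  assumes "sub H" "u \<oplus>\<^bsub>N\<^esub> v \<in> H" "u \<in> H" "v \<in> carrier N"
  shows "v \<in> H"
  using sub_add_cancel[of H v u] assms sub_carrier M.a_comm by metis

lemma smult_diff:
  assumes "r \<in> carrier R" "s \<in> carrier R" "u \<in> carrier N"
  shows "(r \<ominus> s) \<odot>\<^bsub>N\<^esub> u = r \<odot>\<^bsub>N\<^esub> u \<ominus>\<^bsub>N\<^esub> s \<odot>\<^bsub>N\<^esub> u"
  using assms by (simp add: R.minus_eq M.minus_eq smult_l_distr smult_l_minus)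

lemma smult_comm:
  assumes "r \<in> carrier R" "s \<in> carrier R" "u \<in> carrier N"
  shows "r \<odot>\<^bsub>N\<^esub> (s \<odot>\<^bsub>N\<^esub> u) = s \<odot>\<^bsub>N\<^esub> (r \<odot>\<^bsub>N\<^esub> u)"
  using assms by (metis R.m_comm smult_assoc1)

lemma sub_Int: "sub H \<Longrightarrow> sub K \<Longrightarrow> sub (H \<inter> K)"
  by (rule submoduleI) (auto simp: sub_carrier sub_zero sub_neg sub_smult sub_add)

lemma set_add_iff: "u \<in> H <+>\<^bsub>N\<^esub> K \<longleftrightarrow> (\<exists>h\<in>H. \<exists>k\<in>K. u = h \<oplus>\<^bsub>N\<^esub> k)"
  by (auto simp: set_add_def')

lemma four_add:
  assumes "a \<in> carrier N" "b \<in> carrier N" "c \<in> carrier N" "d \<in> carrier N"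
  shows "(a \<oplus>\<^bsub>N\<^esub> b) \<oplus>\<^bsub>N\<^esub> (c \<oplus>\<^bsub>N\<^esub> d) = (a \<oplus>\<^bsub>N\<^esub> c) \<oplus>\<^bsub>N\<^esub> (b \<oplus>\<^bsub>N\<^esub> d)"
  using assms by (simp add: M.a_ac)

lemma sub_set_add:
  assumes "sub H" "sub K" shows "sub (H <+>\<^bsub>N\<^esub> K)"
proof (rule submoduleI)
  note c = sub_carrier[OF assms(1)] sub_carrier[OF assms(2)]
  show "H <+>\<^bsub>N\<^esub> K \<subseteq> carrier N" using c by (auto simp: set_add_iff)
  show "\<zero>\<^bsub>N\<^esub> \<in> H <+>\<^bsub>N\<^esub> K"
    unfolding set_add_iff using assms sub_zero by (metis M.l_zero M.zero_closed)
  fix u assume u: "u \<in> H <+>\<^bsub>N\<^esub> K"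
  then obtain h k where hk: "h \<in> H" "k \<in> K" "u = h \<oplus>\<^bsub>N\<^esub> k" by (auto simp: set_add_iff)
  have "\<ominus>\<^bsub>N\<^esub> u = \<ominus>\<^bsub>N\<^esub> h \<oplus>\<^bsub>N\<^esub> \<ominus>\<^bsub>N\<^esub> k" using hk c by (simp add: M.minus_add)
  then show "\<ominus>\<^bsub>N\<^esub> u \<in> H <+>\<^bsub>N\<^esub> K"
    unfolding set_add_iff using hk assms sub_neg by blast
  { fix v assume "v \<in> H <+>\<^bsub>N\<^esub> K"
    then obtain h' k' where hk': "h' \<in> H" "k' \<in> K" "v = h' \<oplus>\<^bsub>N\<^esub> k'" by (auto simp: set_add_iff)
    have "u \<oplus>\<^bsub>N\<^esub> v = (h \<oplus>\<^bsub>N\<^esub> h') \<oplus>\<^bsub>N\<^esub> (k \<oplus>\<^bsub>N\<^esub> k')"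
      using hk hk' c by (simp add: four_add)
    then show "u \<oplus>\<^bsub>N\<^esub> v \<in> H <+>\<^bsub>N\<^esub> K"
      unfolding set_add_iff using hk hk' assms sub_add by blast }
  { fix a assume a: "a \<in> carrier R"
    have "a \<odot>\<^bsub>N\<^esub> u = a \<odot>\<^bsub>N\<^esub> h \<oplus>\<^bsub>N\<^esub> a \<odot>\<^bsub>N\<^esub> k" using hk c a by (simp add: smult_r_distr)
    then show "a \<odot>\<^bsub>N\<^esub> u \<in> H <+>\<^bsub>N\<^esub> K"
      unfolding set_add_iff using hk assms sub_smult a by blast }
qed

lemma set_add_upper:
  assumes "sub H" "sub K" shows "H \<subseteq> H <+>\<^bsub>N\<^esub> K" "K \<subseteq> H <+>\<^bsub>N\<^esub> K"
  unfolding set_add_iff subset_iff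
  using assms sub_zero sub_carrier M.r_zero M.l_zero by metis+

lemma set_add_least:
  assumes "sub L" "H \<subseteq> L" "K \<subseteq> L" shows "H <+>\<^bsub>N\<^esub> K \<subseteq> L"
  using assms(2,3) by (auto simp: set_add_iff intro!: sub_add[OF assms(1)])

lemma sub_cyclic:
  assumes g: "g \<in> carrier N" shows "sub {r \<odot>\<^bsub>N\<^esub> g | r. r \<in> carrier R}"
proof (rule submoduleI)
  show "\<zero>\<^bsub>N\<^esub> \<in> {r \<odot>\<^bsub>N\<^esub> g | r. r \<in> carrier R}"
    using g by (metis (mono_tags, lifting) R.zero_closed mem_Collect_eq smult_l_null)
next
  fix u assume "u \<in> {r \<odot>\<^bsub>N\<^esub> g | r. r \<in> carrier R}"
  then show "\<ominus>\<^bsub>N\<^esub> u \<in> {r \<odot>\<^bsub>N\<^esub> g | r. r \<in> carrier R}"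
    using g by (auto simp flip: smult_l_minus)
next
  fix u v assume "u \<in> {r \<odot>\<^bsub>N\<^esub> g | r. r \<in> carrier R}" "v \<in> {r \<odot>\<^bsub>N\<^esub> g | r. r \<in> carrier R}"
  then show "u \<oplus>\<^bsub>N\<^esub> v \<in> {r \<odot>\<^bsub>N\<^esub> g | r. r \<in> carrier R}"
    using g by (auto simp flip: smult_l_distr)
next
  fix a u assume "a \<in> carrier R" "u \<in> {r \<odot>\<^bsub>N\<^esub> g | r. r \<in> carrier R}"
  then show "a \<odot>\<^bsub>N\<^esub> u \<in> {r \<odot>\<^bsub>N\<^esub> g | r. r \<in> carrier R}"
    using g by (auto simp flip: smult_assoc1)
qed (use g in auto)

lemma cyclic_self: "g \<in> carrier N \<Longrightarrow> g \<in> {r \<odot>\<^bsub>N\<^esub> g | r. r \<in> carrier R}"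
  by (metis (mono_tags, lifting) R.one_closed mem_Collect_eq smult_one)

lemma sub_smult_image:
  assumes x: "x \<in> carrier R" and A: "sub A" shows "sub ((\<lambda>a. x \<odot>\<^bsub>N\<^esub> a) ` A)"
proof (rule submoduleI)
  note c = sub_carrier[OF A]
  show "(\<lambda>a. x \<odot>\<^bsub>N\<^esub> a) ` A \<subseteq> carrier N" using x c by auto
  show "\<zero>\<^bsub>N\<^esub> \<in> (\<lambda>a. x \<odot>\<^bsub>N\<^esub> a) ` A"
    using x sub_zero[OF A] by (metis image_eqI smult_r_null)
  fix u assume "u \<in> (\<lambda>a. x \<odot>\<^bsub>N\<^esub> a) ` A"
  then obtain a where a: "a \<in> A" "u = x \<odot>\<^bsub>N\<^esub> a" by auto
  show "\<ominus>\<^bsub>N\<^esub> u \<in> (\<lambda>a. x \<odot>\<^bsub>N\<^esub> a) ` A"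
    using x a c sub_neg[OF A] by (metis image_eqI smult_r_minus)
  { fix v assume "v \<in> (\<lambda>a. x \<odot>\<^bsub>N\<^esub> a) ` A"
    then obtain b where b: "b \<in> A" "v = x \<odot>\<^bsub>N\<^esub> b" by auto
    show "u \<oplus>\<^bsub>N\<^esub> v \<in> (\<lambda>a. x \<odot>\<^bsub>N\<^esub> a) ` A"
      using x a b c sub_add[OF A] by (metis image_eqI smult_r_distr) }
  { fix r assume "r \<in> carrier R"
    then show "r \<odot>\<^bsub>N\<^esub> u \<in> (\<lambda>a. x \<odot>\<^bsub>N\<^esub> a) ` A"
      using x a c sub_smult[OF A] by (metis image_eqI smult_comm) }
qed

lemma mult_sum_eq: "mult_sum N x A B = ((\<lambda>a. x \<odot>\<^bsub>N\<^esub> a) ` A) <+>\<^bsub>N\<^esub> B"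
  unfolding mult_sum_def set_add_def' by blast

lemma mult_sumE:
  assumes "u \<in> mult_sum N x A B"
  obtains a b where "a \<in> A" "b \<in> B" "u = x \<odot>\<^bsub>N\<^esub> a \<oplus>\<^bsub>N\<^esub> b"
  using assms by (auto simp: mult_sum_def)

lemma mult_sumI: "a \<in> A \<Longrightarrow> b \<in> B \<Longrightarrow> x \<odot>\<^bsub>N\<^esub> a \<oplus>\<^bsub>N\<^esub> b \<in> mult_sum N x A B"
  by (auto simp: mult_sum_def)

lemma sub_mult_sum: "x \<in> carrier R \<Longrightarrow> sub A \<Longrightarrow> sub B \<Longrightarrow> sub (mult_sum N x A B)"
  by (simp add: mult_sum_eq sub_set_add sub_smult_image)

lemma mult_sum_upper:
  assumes "x \<in> carrier R" "sub A" "sub B"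
  shows "B \<subseteq> mult_sum N x A B" "\<And>a. a \<in> A \<Longrightarrow> x \<odot>\<^bsub>N\<^esub> a \<in> mult_sum N x A B"
  using set_add_upper[OF sub_smult_image[OF assms(1,2)] assms(3)]
  by (auto simp: mult_sum_eq)

lemma mult_sum_least:
  assumes "sub L" "B \<subseteq> L" "\<And>a. a \<in> A \<Longrightarrow> x \<odot>\<^bsub>N\<^esub> a \<in> L"
  shows "mult_sum N x A B \<subseteq> L"
  using set_add_least[OF assms(1), of "(\<lambda>a. x \<odot>\<^bsub>N\<^esub> a) ` A" B] assms(2,3)
  by (auto simp: mult_sum_eq)

lemma mult_sum_subset:
  assumes "x \<in> carrier R" "sub A" "B \<subseteq> A"
  shows "mult_sum N x A B \<subseteq> A"
  using assms by (intro mult_sum_least) (auto intro: sub_smult)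

lemma mult_sum_commute:
  assumes xy: "x \<in> carrier R" "y \<in> carrier R" and "sub A" "sub B"
  shows "mult_sum N x A (mult_sum N y A B) = mult_sum N y A (mult_sum N x A B)"
proof -
  have "mult_sum N x A (mult_sum N y A B) \<subseteq> mult_sum N y A (mult_sum N x A B)"
    if xy: "x \<in> carrier R" "y \<in> carrier R" for x y
    using xy assms(3,4) mult_sum_upper[of x A B]
      mult_sum_upper[OF xy(2) assms(3) sub_mult_sum[OF xy(1) assms(3,4)]]
    by (intro mult_sum_least sub_mult_sum) blast+
  with xy show ?thesis by blast
qed

lemma colon_iff: "r \<in> colon R N B A \<longleftrightarrow> r \<in> carrier R \<and> (\<forall>u\<in>A. r \<odot>\<^bsub>N\<^esub> u \<in> B)"
  by (simp add: colon_def)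

lemma ideal_colon:
  assumes "sub B" "A \<subseteq> carrier N" shows "ideal (colon R N B A) R"
proof (rule idealI[OF R.ring_axioms])
  show "subgroup (colon R N B A) (add_monoid R)"
  proof
    show "colon R N B A \<subseteq> carrier (add_monoid R)" by (auto simp: colon_iff)
    show "\<one>\<^bsub>add_monoid R\<^esub> \<in> colon R N B A"
      using assms sub_zero by (auto simp: colon_iff subset_iff)
    fix x assume x: "x \<in> colon R N B A"
    have "\<ominus> x \<in> colon R N B A"
      using x assms sub_neg by (auto simp: colon_iff subset_iff smult_l_minus)
    then show "inv\<^bsub>add_monoid R\<^esub> x \<in> colon R N B A" by (simp add: a_inv_def)
    fix y assume "y \<in> colon R N B A"
    then show "x \<otimes>\<^bsub>add_monoid R\<^esub> y \<in> colon R N B A"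
      using x assms sub_add by (auto simp: colon_iff subset_iff smult_l_distr)
  qed
  fix a x assume "a \<in> colon R N B A" "x \<in> carrier R"
  then show "x \<otimes> a \<in> colon R N B A"
    using assms sub_smult by (auto simp: colon_iff subset_iff smult_assoc1)
  then show "a \<otimes> x \<in> colon R N B A"
    using \<open>a \<in> _\<close> \<open>x \<in> _\<close> by (simp add: R.m_comm colon_iff)
qed

lemma sub_saturation:
  assumes P: "primeideal P R" and H: "sub H" shows "sub (saturation R N P H)"
proof (rule submoduleI)
  interpret P: primeideal P R by fact
  have mult: "s \<otimes> t \<in> carrier R - P" if "s \<in> carrier R - P" "t \<in> carrier R - P" for s t
    using that P.I_prime by auto
  have one: "\<one> \<in> carrier R - P"
    using P.I_notcarr P.one_imp_carrier by auto
  show "saturation R N P H \<subseteq> carrier N" by (auto simp: saturation_def)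
  show "\<zero>\<^bsub>N\<^esub> \<in> saturation R N P H"
    using one sub_zero[OF H] by (auto simp: saturation_def)
  fix u assume "u \<in> saturation R N P H"
  then obtain s where s: "u \<in> carrier N" "s \<in> carrier R - P" "s \<odot>\<^bsub>N\<^esub> u \<in> H"
    by (auto simp: saturation_def)
  show "\<ominus>\<^bsub>N\<^esub> u \<in> saturation R N P H"
    using s sub_neg[OF H] by (auto simp: saturation_def intro!: bexI[of _ s] simp: smult_r_minus)
  { fix v assume "v \<in> saturation R N P H"
    then obtain t where t: "v \<in> carrier N" "t \<in> carrier R - P" "t \<odot>\<^bsub>N\<^esub> v \<in> H"
      by (auto simp: saturation_def)
    have "(s \<otimes> t) \<odot>\<^bsub>N\<^esub> (u \<oplus>\<^bsub>N\<^esub> v) = t \<odot>\<^bsub>N\<^esub> (s \<odot>\<^bsub>N\<^esub> u) \<oplus>\<^bsub>N\<^esub> s \<odot>\<^bsub>N\<^esub> (t \<odot>\<^bsub>N\<^esub> v)"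
      using s t by (simp add: smult_r_distr smult_assoc1 smult_comm[of t s u])
    also have "\<dots> \<in> H" using s t sub_add[OF H] sub_smult[OF H] by simp
    finally show "u \<oplus>\<^bsub>N\<^esub> v \<in> saturation R N P H"
      using mult[OF s(2) t(2)] s t unfolding saturation_def by blast }
  { fix a assume a: "a \<in> carrier R"
    have "s \<odot>\<^bsub>N\<^esub> (a \<odot>\<^bsub>N\<^esub> u) = a \<odot>\<^bsub>N\<^esub> (s \<odot>\<^bsub>N\<^esub> u)" using a s by (simp add: smult_comm)
    also have "\<dots> \<in> H" using s a sub_smult[OF H] by simp
    finally show "a \<odot>\<^bsub>N\<^esub> u \<in> saturation R N P H"
      using s a unfolding saturation_def by blast }
qed

lemma saturation_upper:
  assumes P: "primeideal P R" and H: "sub H" shows "H \<subseteq> saturation R N P H"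
proof
  interpret P: primeideal P R by fact
  fix u assume "u \<in> H"
  moreover have "\<one> \<in> carrier R - P"
    using P.I_notcarr P.one_imp_carrier by auto
  ultimately show "u \<in> saturation R N P H"
    using sub_carrier[OF H] unfolding saturation_def by force
qed

lemma saturation_mono: "H \<subseteq> K \<Longrightarrow> saturation R N P H \<subseteq> saturation R N P K"
  by (auto simp: saturation_def)

lemma saturation_idem:
  assumes P: "primeideal P R"
  shows "saturation R N P (saturation R N P H) \<subseteq> saturation R N P H"
proof
  interpret P: primeideal P R by fact
  fix u assume "u \<in> saturation R N P (saturation R N P H)"
  then obtain s t where *: "u \<in> carrier N" "s \<in> carrier R - P" "t \<in> carrier R - P"
    "t \<odot>\<^bsub>N\<^esub> (s \<odot>\<^bsub>N\<^esub> u) \<in> H" by (auto simp: saturation_def)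
  then have "t \<otimes> s \<in> carrier R - P" "(t \<otimes> s) \<odot>\<^bsub>N\<^esub> u \<in> H"
    using P.I_prime by (auto simp: smult_assoc1)
  with * show "u \<in> saturation R N P H" unfolding saturation_def by blast
qed

end

text \<open>The maximal condition, rather than finite generation, is assumed because it applies at
  once to any family of submodules. The ring is required to be Noetherian separately since
  annihilators are chosen maximal among its ideals.\<close>

locale noetherian_module = module_over +
  assumes noetherian: "noetherian_ring R"
    and maximal_submodule_exists:
    "\<HH> \<noteq> {} \<Longrightarrow> (\<And>H. H \<in> \<HH> \<Longrightarrow> submodule H R N) \<Longrightarrow> \<exists>H\<in>\<HH>. \<forall>K\<in>\<HH>. H \<subseteq> K \<longrightarrow> K = H"
begin

lemma maximal_submodule_indexed:
  assumes "V \<noteq> {}" and "\<And>x. x \<in> V \<Longrightarrow> sub (H x)"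
  shows "\<exists>x\<in>V. \<forall>y\<in>V. H x \<subseteq> H y \<longrightarrow> H y = H x"
  using maximal_submodule_exists[of "H ` V"] assms by auto

text \<open>A maximal counterexample \<open>L \<supseteq> K\<close> not containing \<open>H\<close> contains \<open>x H\<close>.\<close>

lemma nakayama_saturation:
  assumes P: "primeideal P R" and x: "x \<in> P" and H: "sub H" and K: "sub K"
    and HK: "H \<subseteq> saturation R N P (mult_sum N x H K)"
  shows "H \<subseteq> saturation R N P K"
proof (rule ccontr)
  interpret P: primeideal P R by fact
  have xR: "x \<in> carrier R" using x by (rule P.a_Hcarr)
  assume neg: "\<not> H \<subseteq> saturation R N P K"
  define \<LL> where "\<LL> = {L. sub L \<and> K \<subseteq> L \<and> saturation R N P L = L \<and> \<not> H \<subseteq> L}"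
  have "saturation R N P K \<in> \<LL>"
    unfolding \<LL>_def
    using sub_saturation[OF P K] saturation_upper[OF P K] saturation_idem[OF P]
      saturation_upper[OF P sub_saturation[OF P K]] neg by blast
  then have "\<LL> \<noteq> {}" by blast
  moreover have "sub L" if "L \<in> \<LL>" for L using that by (simp add: \<LL>_def)
  ultimately have "\<exists>L\<in>\<LL>. \<forall>L'\<in>\<LL>. L \<subseteq> L' \<longrightarrow> L' = L"
    by (rule maximal_submodule_exists)
  then obtain L where L: "L \<in> \<LL>" "\<And>L'. L' \<in> \<LL> \<Longrightarrow> L \<subseteq> L' \<Longrightarrow> L' = L"
    by metis
  then have L': "sub L" "K \<subseteq> L" "saturation R N P L = L" "\<not> H \<subseteq> L" by (auto simp: \<LL>_def)
  have "x \<odot>\<^bsub>N\<^esub> h \<in> L" if h: "h \<in> H" for h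
  proof (rule ccontr)
    assume xh: "x \<odot>\<^bsub>N\<^esub> h \<notin> L"
    have hN: "h \<in> carrier N" using h sub_carrier[OF H] by blast
    let ?C = "{r \<odot>\<^bsub>N\<^esub> (x \<odot>\<^bsub>N\<^esub> h) | r. r \<in> carrier R}"
    have C: "sub ?C" using xR hN by (intro sub_cyclic) auto
    let ?L = "saturation R N P (L <+>\<^bsub>N\<^esub> ?C)"
    have LC: "sub (L <+>\<^bsub>N\<^esub> ?C)" using L'(1) C by (rule sub_set_add)
    have up: "L \<subseteq> ?L" "x \<odot>\<^bsub>N\<^esub> h \<in> ?L"
      using set_add_upper[OF L'(1) C] saturation_upper[OF P LC]
        cyclic_self[of "x \<odot>\<^bsub>N\<^esub> h"] xR hN by auto
    have "?L \<notin> \<LL>" using L(2)[of ?L] up xh by auto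
    then have "H \<subseteq> ?L"
      unfolding \<LL>_def using sub_saturation[OF P LC] up(1) L'(2) saturation_idem[OF P]
        saturation_upper[OF P sub_saturation[OF P LC]] by blast
    with h obtain s l r where s: "s \<in> carrier R - P" "l \<in> L" "r \<in> carrier R"
      "s \<odot>\<^bsub>N\<^esub> h = l \<oplus>\<^bsub>N\<^esub> r \<odot>\<^bsub>N\<^esub> (x \<odot>\<^bsub>N\<^esub> h)"
      by (auto simp: saturation_def set_add_iff)
    have lN: "l \<in> carrier N" using s(2) sub_carrier[OF L'(1)] by blast
    \<comment> \<open>The relation \<open>s h = l + r x h\<close> is solved for \<open>h\<close>: as
      \<open>s\<close> is outside \<open>P\<close> and \<open>x\<close> inside,
      \<open>s - r x\<close> is outside \<open>P\<close>, a unit after localization.\<close>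
    have "(s \<ominus> r \<otimes> x) \<odot>\<^bsub>N\<^esub> h = l"
      using s xR hN lN
      by (simp add: smult_diff smult_assoc1) (simp add: M.minus_eq M.a_assoc M.r_neg)
    moreover have "s \<ominus> r \<otimes> x \<notin> P"
    proof
      assume "s \<ominus> r \<otimes> x \<in> P"
      moreover have "r \<otimes> x \<in> P" using P.I_l_closed x s(3) by blast
      ultimately have "(s \<ominus> r \<otimes> x) \<oplus> r \<otimes> x \<in> P" by (rule P.a_closed)
      moreover have "(s \<ominus> r \<otimes> x) \<oplus> r \<otimes> x = s"
        using s xR by (simp add: R.minus_eq R.a_assoc R.l_neg)
      ultimately show False using s(1) by simp
    qed
    ultimately have "h \<in> saturation R N P L"
      using s xR hN unfolding saturation_def
      by (auto intro!: bexI[of _ "s \<ominus> r \<otimes> x"])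
    then have "h \<in> L" using L'(3) by simp
    then show False using xh sub_smult[OF L'(1) xR] by blast
  qed
  then have "mult_sum N x H K \<subseteq> L" using L' by (intro mult_sum_least)
  then have "H \<subseteq> L" using HK saturation_mono[of _ L P] L'(3) by blast
  then show False using L'(4) by blast
qed

end

section \<open>Prime avoidance and maximal annihilators\<close>

lemma (in cring) prime_contains_factor:
  assumes "finite F" and "\<And>Q. Q \<in> F \<Longrightarrow> ideal Q R" and P: "primeideal P R"
    and "{r \<in> carrier R. \<forall>Q\<in>F. r \<in> Q} \<subseteq> P"
  shows "\<exists>Q\<in>F. Q \<subseteq> P"
  using assms(1,2,4)
proof (induction F)
  case empty
  interpret P: primeideal P R by fact
  have "P = carrier R" using empty.prems(2) P.a_subset by auto
  then show ?case using P.I_notcarr by simp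
next
  case (insert Q F)
  interpret P: primeideal P R by fact
  interpret Q: ideal Q R using insert.prems(1) by blast
  show ?case
  proof (rule ccontr)
    assume no: "\<not> ?case"
    then have "\<not> {r \<in> carrier R. \<forall>Q\<in>F. r \<in> Q} \<subseteq> P" using insert by blast
    then obtain r where r: "r \<in> carrier R" "\<And>Q. Q \<in> F \<Longrightarrow> r \<in> Q" "r \<notin> P" by blast
    obtain q where q: "q \<in> Q" "q \<notin> P" using no by blast
    have qR: "q \<in> carrier R" using q Q.a_Hcarr by blast
    have "q \<otimes> r \<in> Q'" if "Q' \<in> insert Q F" for Q'
    proof (cases "Q' = Q")
      case True then show ?thesis using Q.I_r_closed q r by blast
    next
      case False
      then interpret Q': ideal Q' R using insert.prems(1) that by blast
      show ?thesis using Q'.I_l_closed r qR that False by blast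
    qed
    then have "q \<otimes> r \<in> P" using insert.prems(2) qR r by blast
    then show False using P.I_prime qR q r by blast
  qed
qed

lemma (in cring) prime_avoidance:
  assumes "finite F" and "\<And>P. P \<in> F \<Longrightarrow> primeideal P R" and I: "ideal I R"
    and "\<And>P. P \<in> F \<Longrightarrow> \<not> I \<subseteq> P"
  shows "\<exists>x\<in>I. \<forall>P\<in>F. x \<notin> P"
  using assms(1,2,4)
proof (induction F rule: finite_psubset_induct)
  case (psubset F)
  interpret I: ideal I R by fact
  show ?case
  proof (cases "F = {}")
    case True
    then show ?thesis using I.zero_closed by (intro bexI[of _ \<zero>]) auto
  next
    case False
    then obtain P where P: "P \<in> F" by blast
    interpret P: primeideal P R using psubset.prems(1) P by blast
    show ?thesis
    proof (cases "\<exists>Q\<in>F. \<exists>P\<in>F. Q \<subset> P")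
      case True
      then obtain Q P where QP: "Q \<in> F" "P \<in> F" "Q \<subset> P" by blast
      then have "\<exists>x\<in>I. \<forall>P\<in>F - {Q}. x \<notin> P"
        using psubset.IH[of "F - {Q}"] psubset.prems by blast
      with QP show ?thesis by blast
    next
      case incomparable: False
      obtain x where x: "x \<in> I" "\<And>Q. Q \<in> F - {P} \<Longrightarrow> x \<notin> Q"
        using psubset.IH[of "F - {P}"] psubset.prems P by blast
      have xR: "x \<in> carrier R" using x I.a_Hcarr by blast
      show ?thesis
      proof (cases "x \<in> P")
        case False then show ?thesis using x by blast
      next
        case True
        \<comment> \<open>Neither \<open>I\<close> nor another prime of \<open>F\<close> lies in
          \<open>P\<close>; hence some \<open>y\<close> lies in \<open>I\<close> and in all the
          other primes but not in \<open>P\<close>. Adding \<open>y\<close> to \<open>x\<close>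
          changes nothing modulo the other primes and moves the sum out of \<open>P\<close>.\<close>
        have "\<not> {r \<in> carrier R. \<forall>Q\<in>insert I (F - {P}). r \<in> Q} \<subseteq> P"
        proof
          assume "{r \<in> carrier R. \<forall>Q\<in>insert I (F - {P}). r \<in> Q} \<subseteq> P"
          moreover have "ideal Q R" if "Q \<in> insert I (F - {P})" for Q
            using that psubset.prems(1) I primeideal.axioms(1) by blast
          ultimately have "\<exists>Q\<in>insert I (F - {P}). Q \<subseteq> P"
            using prime_contains_factor[of "insert I (F - {P})" P] psubset.hyps P.primeideal
            by (metis finite_Diff finite_insert)
          then show False using incomparable psubset.prems(2) P by blast
        qed
        then obtain y where y: "y \<in> I" "\<And>Q. Q \<in> F - {P} \<Longrightarrow> y \<in> Q" "y \<notin> P" by blast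
        have yR: "y \<in> carrier R" using y I.a_Hcarr by blast
        have cancel: "(x \<oplus> y) \<oplus> \<ominus> y = x" "(x \<oplus> y) \<oplus> \<ominus> x = y"
          using xR yR by (simp_all add: a_assoc r_neg) (metis a_comm a_inv_closed a_assoc l_neg l_zero)
        have "x \<oplus> y \<notin> Q" if Q: "Q \<in> F" for Q
        proof
          assume xy: "x \<oplus> y \<in> Q"
          interpret Q: primeideal Q R using psubset.prems(1) Q by blast
          show False
          proof (cases "Q = P")
            case True
            then have "y \<in> P" using Q.a_closed[OF xy, of "\<ominus> x"] Q.a_inv_closed \<open>x \<in> P\<close> cancel by simp
            then show False using y by blast
          next
            case False
            then have "x \<in> Q" using Q.a_closed[OF xy, of "\<ominus> y"] Q.a_inv_closed y Q cancel by simp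
            then show False using x False Q by blast
          qed
        qed
        then show ?thesis using I.a_closed x y by blast
      qed
    qed
  qed
qed

text \<open>Ideals of \<open>R\<close> become submodules, so that Nakayama's lemma and the
  saturation calculus apply to them in the proof of the principal ideal theorem.\<close>

definition ring_module :: "('a, 'r) ring_scheme \<Rightarrow> ('a, 'a) module"
  where "ring_module R = \<lparr>carrier = carrier R, monoid.mult = monoid.mult R, one = one R,
    ring.zero = ring.zero R, ring.add = ring.add R, smult = monoid.mult R\<rparr>"

lemma ring_module_simps [simp]:
  "carrier (ring_module R) = carrier R" "ring.zero (ring_module R) = ring.zero R"
  "ring.add (ring_module R) = ring.add R" "module.smult (ring_module R) = monoid.mult R"
  by (simp_all add: ring_module_def)

lemma (in cring) module_ring_module: "module R (ring_module R)"
proof (rule moduleI)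
  show "abelian_group (ring_module R)"
    by (rule abelian_groupI) (auto simp: a_ac intro: bexI[of _ "\<ominus> _"] l_neg)
qed (auto simp: l_distr r_distr m_assoc is_cring)

lemma (in cring) submodule_ring_module_iff: "submodule I R (ring_module R) \<longleftrightarrow> ideal I R"
proof
  note R_minus_equality = minus_equality and R_subgroupI = add.subgroupI and R_ring = ring_axioms
    and R_comm = m_comm
  interpret module R "ring_module R" by (rule module_ring_module)
  have neg: "\<ominus>\<^bsub>ring_module R\<^esub> x = \<ominus> x" if "x \<in> carrier R" for x
    using that R_minus_equality[of "\<ominus>\<^bsub>ring_module R\<^esub> x" x] M.a_inv_closed[of x] M.l_neg[of x] by simp
  { assume I: "submodule I R (ring_module R)"
    note E = submoduleE[OF I, simplified]
    show "ideal I R"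
    proof (rule idealI[OF R_ring])
      show "subgroup I (add_monoid R)"
        using E neg by (intro R_subgroupI) (auto simp: subset_iff simp flip: a_inv_def)
    qed (use E R_comm in \<open>metis subsetD\<close>)+ }
  { assume "ideal I R"
    then interpret ideal I R .
    show "submodule I R (ring_module R)"
      by (rule submoduleI) (auto simp: neg a_subset I_l_closed) }
qed

lemma noetherian_module_ring_module:
  assumes "noetherian_ring R" "cring R" shows "noetherian_module R (ring_module R)"
proof -
  interpret cring R by fact
  interpret noetherian_ring R by fact
  show ?thesis
  proof (intro noetherian_module.intro noetherian_module_axioms.intro module_over.intro)
    fix \<HH> assume "\<HH> \<noteq> {}" "\<And>H. H \<in> \<HH> \<Longrightarrow> submodule H R (ring_module R)"
    then show "\<exists>H\<in>\<HH>. \<forall>K\<in>\<HH>. H \<subseteq> K \<longrightarrow> K = H"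
      using maximal_ideal_exists[of \<HH> "\<lambda>H. H"] by (simp add: submodule_ring_module_iff)
  qed (fact module_ring_module assms(1))+
qed

section \<open>Finitely generated modules over Noetherian rings\<close>

context module_over
begin

definition acc_below :: "'c set \<Rightarrow> bool"
  where "acc_below K \<longleftrightarrow> (\<forall>\<HH>. \<HH> \<noteq> {} \<longrightarrow> (\<forall>H\<in>\<HH>. sub H \<and> H \<subseteq> K) \<longrightarrow>
    (\<exists>H\<in>\<HH>. \<forall>H'\<in>\<HH>. H \<subseteq> H' \<longrightarrow> H' = H))"

lemma acc_below_mono: "acc_below K \<Longrightarrow> L \<subseteq> K \<Longrightarrow> acc_below L"
  unfolding acc_below_def by (meson subset_trans)

text \<open>A submodule \<open>H\<close> of \<open>K + R g\<close> is controlled by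
  \<open>H \<inter> K\<close> and by the ideal \<open>J H\<close> of the \<open>r\<close> with
  \<open>r g\<close> in \<open>H + K\<close>: two nested submodules with the same data coincide. So
  \<open>J H\<close> is made maximal first, in \<open>R\<close>, and then
  \<open>H \<inter> K\<close> among the \<open>H\<close> with that \<open>J H\<close>, in
  \<open>K\<close>.\<close>

lemma acc_below_add_cyclic:
  assumes noeth: "noetherian_ring R" and K: "sub K" and acc: "acc_below K"
    and g: "g \<in> carrier N"
  shows "acc_below (K <+>\<^bsub>N\<^esub> {r \<odot>\<^bsub>N\<^esub> g | r. r \<in> carrier R})"
  unfolding acc_below_def
proof (intro allI impI)
  fix \<HH> assume ne: "\<HH> \<noteq> {}"
    and \<HH>: "\<forall>H\<in>\<HH>. sub H \<and> H \<subseteq> K <+>\<^bsub>N\<^esub> {r \<odot>\<^bsub>N\<^esub> g | r. r \<in> carrier R}"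
  define J where "J H = colon R N (H <+>\<^bsub>N\<^esub> K) {g}" for H
  have "\<exists>H0\<in>\<HH>. \<forall>H\<in>\<HH>. J H0 \<subseteq> J H \<longrightarrow> J H = J H0"
    using ne \<HH> g K unfolding J_def
    by (intro noetherian_ring.maximal_ideal_exists[OF noeth]) (auto intro!: ideal_colon sub_set_add)
  then obtain H0 where H0: "H0 \<in> \<HH>" "\<forall>H\<in>\<HH>. J H0 \<subseteq> J H \<longrightarrow> J H = J H0"
    by (rule bexE) (rule that)
  let ?\<HH> = "{H \<in> \<HH>. J H = J H0}"
  have "\<exists>L\<in>(\<lambda>H. H \<inter> K) ` ?\<HH>. \<forall>L'\<in>(\<lambda>H. H \<inter> K) ` ?\<HH>. L \<subseteq> L' \<longrightarrow> L' = L"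
    by (rule acc[unfolded acc_below_def, rule_format])
      (use H0(1) \<HH> K sub_Int in auto)
  then have "\<exists>H\<in>?\<HH>. \<forall>H'\<in>?\<HH>. H \<inter> K \<subseteq> H' \<inter> K \<longrightarrow> H' \<inter> K = H \<inter> K"
    unfolding bex_simps(7) ball_simps(9) .
  then obtain H where H: "H \<in> ?\<HH>"
    and Hmax: "\<forall>H'\<in>?\<HH>. H \<inter> K \<subseteq> H' \<inter> K \<longrightarrow> H' \<inter> K = H \<inter> K"
    by (rule bexE) (rule that)
  have "H' = H" if H': "H' \<in> \<HH>" and le: "H \<subseteq> H'" for H'
  proof
    have sH: "sub H" "sub H'" using H H' \<HH> by auto
    have "H <+>\<^bsub>N\<^esub> K \<subseteq> H' <+>\<^bsub>N\<^esub> K" using le unfolding subset_iff set_add_iff by blast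
    then have "J H \<subseteq> J H'" by (auto simp: J_def colon_iff)
    then have J: "J H' = J H" using H0(2) H' H by auto
    then have HK: "H' \<inter> K = H \<inter> K" using bspec[OF Hmax, of H'] H' le H by auto
    show "H' \<subseteq> H"
    proof
      fix h' assume h': "h' \<in> H'"
      then obtain k r where k: "k \<in> K" "r \<in> carrier R" "h' = k \<oplus>\<^bsub>N\<^esub> r \<odot>\<^bsub>N\<^esub> g"
        using \<HH> H' by (fastforce simp: set_add_iff)
      have kN: "k \<in> carrier N" and rg: "r \<odot>\<^bsub>N\<^esub> g \<in> carrier N"
        using k g sub_carrier[OF K] by auto
      have "h' \<oplus>\<^bsub>N\<^esub> \<ominus>\<^bsub>N\<^esub> k = r \<odot>\<^bsub>N\<^esub> g"
        using kN rg k(3) by (simp add: M.a_comm[of k] M.a_assoc M.r_neg)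
      then have "r \<odot>\<^bsub>N\<^esub> g \<in> H' <+>\<^bsub>N\<^esub> K"
        using h' sub_neg[OF K k(1)] unfolding set_add_iff by metis
      \<comment> \<open>Since the two ideals agree, \<open>r g\<close> can be rewritten with some
        \<open>h\<close> in \<open>H\<close>; then \<open>h' - h\<close> lies in
        \<open>H' \<inter> K\<close>, which equals \<open>H \<inter> K\<close>.\<close>
      then have "r \<in> J H" using J k(2) by (auto simp: J_def colon_iff)
      then obtain h k' where h: "h \<in> H" "k' \<in> K" "r \<odot>\<^bsub>N\<^esub> g = h \<oplus>\<^bsub>N\<^esub> k'"
        by (auto simp: J_def colon_iff set_add_iff)
      have hN: "h \<in> carrier N" "k' \<in> carrier N"
        using h sub_carrier[OF sH(1)] sub_carrier[OF K] by auto
      have eq: "h' = (k \<oplus>\<^bsub>N\<^esub> k') \<oplus>\<^bsub>N\<^esub> h" using k(3) h(3) kN hN by (simp add: M.a_ac)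
      have "k \<oplus>\<^bsub>N\<^esub> k' \<in> H'"
        using sub_add_cancel[OF sH(2)] eq h' kN hN h(1) le by auto
      then have "k \<oplus>\<^bsub>N\<^esub> k' \<in> H" using HK sub_add[OF K k(1) h(2)] by blast
      then show "h' \<in> H" using eq sub_add[OF sH(1)] h(1) by simp
    qed
  qed (fact le)
  then show "\<exists>H\<in>\<HH>. \<forall>H'\<in>\<HH>. H \<subseteq> H' \<longrightarrow> H' = H" using H by auto
qed

lemma sub_gen_submodule: "S \<subseteq> carrier N \<Longrightarrow> sub (gen_submodule R N S)"
proof (rule submoduleI)
  assume S: "S \<subseteq> carrier N"
  then show "gen_submodule R N S \<subseteq> carrier N"
    using carrier_is_submodule by (auto simp: gen_submodule_def)
qed (auto simp: gen_submodule_def intro: sub_zero sub_neg sub_add sub_smult)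

lemma gen_submodule_upper: "S \<subseteq> gen_submodule R N S"
  by (auto simp: gen_submodule_def)

lemma gen_submodule_least: "sub H \<Longrightarrow> S \<subseteq> H \<Longrightarrow> gen_submodule R N S \<subseteq> H"
  by (auto simp: gen_submodule_def)

lemma acc_below_gen_submodule:
  assumes noeth: "noetherian_ring R" and "finite S" "S \<subseteq> carrier N"
  shows "acc_below (gen_submodule R N S)"
  using assms(2,3)
proof (induction S)
  case empty
  have "sub {\<zero>\<^bsub>N\<^esub>}" by (rule submoduleI) auto
  then have "gen_submodule R N {} \<subseteq> {\<zero>\<^bsub>N\<^esub>}" by (rule gen_submodule_least) simp
  then have "H = {\<zero>\<^bsub>N\<^esub>}" if "sub H" "H \<subseteq> gen_submodule R N {}" for H
    using sub_zero[OF that(1)] that(2) by blast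
  then show ?case unfolding acc_below_def by (metis all_not_in_conv)
next
  case (insert g S)
  let ?C = "{r \<odot>\<^bsub>N\<^esub> g | r. r \<in> carrier R}"
  have g: "g \<in> carrier N" and S: "S \<subseteq> carrier N" using insert.prems by auto
  note K = sub_gen_submodule[OF S] and C = sub_cyclic[OF g]
  have "gen_submodule R N (insert g S) \<subseteq> gen_submodule R N S <+>\<^bsub>N\<^esub> ?C"
    using set_add_upper[OF K C] cyclic_self[OF g] gen_submodule_upper[of S]
    by (intro gen_submodule_least sub_set_add K C) blast
  then show ?case
    using acc_below_mono acc_below_add_cyclic[OF noeth K insert.IH[OF S] g] by blast
qed

lemma noetherian_module_fin_gen:
  assumes "noetherian_ring R" "fin_gen_module R N" shows "noetherian_module R N"
proof (intro noetherian_module.intro noetherian_module_axioms.intro)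
  obtain S where "S \<subseteq> carrier N" "finite S" "gen_submodule R N S = carrier N"
    using assms(2) by (auto simp: fin_gen_module_def)
  then have acc: "acc_below (carrier N)" using acc_below_gen_submodule[OF assms(1)] by metis
  show "\<exists>H\<in>\<HH>. \<forall>K\<in>\<HH>. H \<subseteq> K \<longrightarrow> K = H" if "\<HH> \<noteq> {}" "\<And>H. H \<in> \<HH> \<Longrightarrow> sub H" for \<HH>
    using acc[unfolded acc_below_def, rule_format, OF that(1)] that(2) sub_carrier by blast
qed (fact module_over_axioms assms(1))+

end

section \<open>Maximal annihilators as the maximal associated primes\<close>

context noetherian_module
begin

text \<open>For submodules \<open>B\<close> inside \<open>A\<close>, these are the maximal elements
  of \<open>Ass (A / B)\<close>, and their union is the set of zero divisors on
  \<open>A / B\<close>. That is all prime avoidance needs, and finiteness of this set can be had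
  without a prime filtration.\<close>

definition maximal_annihilators :: "'c set \<Rightarrow> 'c set \<Rightarrow> 'a set set"
  where "maximal_annihilators A B = {P. \<exists>u\<in>A - B. P = colon R N B {u} \<and>
    (\<forall>v\<in>A - B. P \<subseteq> colon R N B {v} \<longrightarrow> colon R N B {v} = P)}"

lemma maximal_annihilator_above:
  assumes "sub A" "sub B" "u \<in> A" "u \<notin> B"
  shows "\<exists>P\<in>maximal_annihilators A B. colon R N B {u} \<subseteq> P"
proof -
  let ?V = "{v \<in> A - B. colon R N B {u} \<subseteq> colon R N B {v}}"
  have "\<exists>v\<in>?V. \<forall>w\<in>?V. colon R N B {v} \<subseteq> colon R N B {w} \<longrightarrow> colon R N B {w} = colon R N B {v}"
    using assms by (intro noetherian_ring.maximal_ideal_exists[OF noetherian])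
      (auto intro!: ideal_colon sub_carrier[OF assms(1)])
  then obtain v where v: "v \<in> ?V"
    and max: "\<forall>w\<in>?V. colon R N B {v} \<subseteq> colon R N B {w} \<longrightarrow> colon R N B {w} = colon R N B {v}"
    by (rule bexE) (rule that)
  have "colon R N B {v} \<in> maximal_annihilators A B"
    unfolding maximal_annihilators_def using v max by (auto 0 4)
  with v show ?thesis by blast
qed

lemma maximal_annihilator_prime:
  assumes A: "sub A" and B: "sub B" and P: "P \<in> maximal_annihilators A B"
  shows "primeideal P R"
proof -
  obtain u where u: "u \<in> A" "u \<notin> B" "P = colon R N B {u}"
    and max: "\<And>v. v \<in> A \<Longrightarrow> v \<notin> B \<Longrightarrow> P \<subseteq> colon R N B {v} \<Longrightarrow> colon R N B {v} = P"
    using P unfolding maximal_annihilators_def by auto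
  have uN: "u \<in> carrier N" using u sub_carrier[OF A] by blast
  show ?thesis
  proof (rule primeidealI)
    show "ideal P R" using u uN B by (auto intro: ideal_colon)
    show "cring R" by (rule R.is_cring)
    have "\<one> \<notin> P" using u(2) uN by (simp add: u(3) colon_iff)
    then show "carrier R \<noteq> P" by auto
    fix r s assume rs: "r \<in> carrier R" "s \<in> carrier R" "r \<otimes> s \<in> P"
    have "r \<in> P" if "s \<notin> P"
    proof -
      have "s \<odot>\<^bsub>N\<^esub> u \<in> A" "s \<odot>\<^bsub>N\<^esub> u \<notin> B"
        using that rs u sub_smult[OF A] by (auto simp: colon_iff)
      moreover have "P \<subseteq> colon R N B {s \<odot>\<^bsub>N\<^esub> u}"
        using rs(2) u uN sub_smult[OF B] by (auto simp: colon_iff smult_comm[of _ s])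
      ultimately have "colon R N B {s \<odot>\<^bsub>N\<^esub> u} = P" by (rule max)
      moreover have "r \<in> colon R N B {s \<odot>\<^bsub>N\<^esub> u}"
        using rs u uN by (auto simp: colon_iff smult_assoc1)
      ultimately show ?thesis by blast
    qed
    then show "r \<in> P \<or> s \<in> P" by blast
  qed
qed

text \<open>\<open>H F\<close> consists of the elements of \<open>A\<close> that the intersection of
  \<open>F\<close> carries into \<open>B\<close>, so it grows with \<open>F\<close>. Take a finite
  \<open>F\<close> with \<open>H F\<close> maximal. For \<open>P = (B : u)\<close>, adjoining
  \<open>P\<close> to \<open>F\<close> shows that \<open>u\<close> is in \<open>H F\<close>, so the
  intersection of \<open>F\<close> annihilates \<open>u\<close> modulo \<open>B\<close> and lies in
  \<open>P\<close>. A prime containing a finite intersection contains one of the ideals, and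
  maximality makes that one equal to \<open>P\<close>.\<close>

lemma finite_maximal_annihilators:
  assumes A: "sub A" and B: "sub B"
  shows "finite (maximal_annihilators A B)"
proof -
  let ?\<P> = "maximal_annihilators A B"
  define H where "H F = {u \<in> A. \<forall>r\<in>carrier R. (\<forall>P\<in>F. r \<in> P) \<longrightarrow> r \<odot>\<^bsub>N\<^esub> u \<in> B}" for F
  have sub: "sub (H F)" if "F \<subseteq> ?\<P>" for F
  proof (rule submoduleI)
    show "H F \<subseteq> carrier N" using sub_carrier[OF A] by (auto simp: H_def)
    show "\<zero>\<^bsub>N\<^esub> \<in> H F" using sub_zero[OF A] sub_zero[OF B] by (simp add: H_def)
    fix u assume u: "u \<in> H F"
    then have uA: "u \<in> A" "u \<in> carrier N" using sub_carrier[OF A] by (simp_all add: H_def)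
    show "\<ominus>\<^bsub>N\<^esub> u \<in> H F"
      using u uA sub_neg[OF A] sub_neg[OF B] by (simp add: H_def smult_r_minus)
    { fix v assume v: "v \<in> H F"
      then have "v \<in> A" "v \<in> carrier N" using sub_carrier[OF A] by (simp_all add: H_def)
      then show "u \<oplus>\<^bsub>N\<^esub> v \<in> H F"
        using u v uA sub_add[OF A] sub_add[OF B] by (simp add: H_def smult_r_distr) }
    { fix a assume "a \<in> carrier R"
      then show "a \<odot>\<^bsub>N\<^esub> u \<in> H F"
        using u uA sub_smult[OF A] sub_smult[OF B] by (simp add: H_def smult_comm[of _ a]) }
  qed
  let ?F = "{F. finite F \<and> F \<subseteq> ?\<P>}"
  have "\<exists>F\<in>?F. \<forall>F'\<in>?F. H F \<subseteq> H F' \<longrightarrow> H F' = H F"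
    by (rule maximal_submodule_indexed) (use sub in auto)
  then obtain F where F: "F \<in> ?F" and Fmax: "\<forall>F'\<in>?F. H F \<subseteq> H F' \<longrightarrow> H F' = H F"
    by (rule bexE) (rule that)
  have "P \<in> F" if P: "P \<in> ?\<P>" for P
  proof -
    obtain u where u: "u \<in> A" "P = colon R N B {u}"
      using P unfolding maximal_annihilators_def by blast
    have "H (insert P F) = H F" using F P by (intro Fmax[rule_format]) (auto simp: H_def)
    moreover have "u \<in> H (insert P F)" using u by (auto simp: H_def colon_iff)
    ultimately have "{r \<in> carrier R. \<forall>Q\<in>F. r \<in> Q} \<subseteq> P" using u by (auto simp: H_def colon_iff)
    then obtain Q where Q: "Q \<in> F" "Q \<subseteq> P"
      using R.prime_contains_factor[of F P] maximal_annihilator_prime[OF A B] F P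
        primeideal.axioms(1) by blast
    have "P = Q"
      using Q F P unfolding maximal_annihilators_def by auto
    with Q show ?thesis by simp
  qed
  then have "?\<P> \<subseteq> F" by blast
  then show ?thesis using F finite_subset by auto
qed

end

section \<open>Depth of subquotients over a local ring\<close>

locale noetherian_local_ring = noetherian_ring R + local_ring R M for R (structure) and M
begin

lemma proper_ideal_subset_maximal:
  assumes I: "ideal I R" "I \<noteq> carrier R"
  shows "I \<subseteq> M"
proof -
  let ?V = "{J. ideal J R \<and> J \<noteq> carrier R \<and> I \<subseteq> J}"
  have "\<exists>J\<in>?V. \<forall>K\<in>?V. J \<subseteq> K \<longrightarrow> K = J"
    using I by (intro maximal_ideal_exists) auto
  then obtain J where J: "J \<in> ?V" and max: "\<forall>K\<in>?V. J \<subseteq> K \<longrightarrow> K = J"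
    by (rule bexE) (rule that)
  have "maximalideal J R"
  proof (rule maximalidealI)
    fix K assume "ideal K R" "J \<subseteq> K" "K \<subseteq> carrier R"
    then show "K = J \<or> K = carrier R" using J bspec[OF max, of K] by auto
  qed (use J in auto)
  with J maximal_unique show ?thesis by auto
qed

lemma primeideal_maximal: "primeideal M R"
  using maximal by (rule maximalideal_prime)

lemma maximal_subset_carrier: "x \<in> M \<Longrightarrow> x \<in> carrier R"
  using ideal.Icarr[OF maximalideal.axioms(1)[OF maximal]] by blast

lemma invertible_outside_maximal:
  assumes s: "s \<in> carrier R" "s \<notin> M"
  shows "\<exists>t\<in>carrier R. t \<otimes> s = \<one>"
proof -
  have "PIdl s = carrier R"
    using proper_ideal_subset_maximal[OF cgenideal_ideal[OF s(1)]] cgenideal_self[OF s(1)] s(2) by blast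
  then have "\<one> \<in> PIdl s" by simp
  then show ?thesis by (auto simp: cgenideal_def)
qed

end

text \<open>Both ends are recorded, since chains are prolonged at either end and the lower end is
  what a quotient ring or an associated prime prescribes. The index counts inclusions.\<close>

inductive prime_chain :: "('a, 'r) ring_scheme \<Rightarrow> nat \<Rightarrow> 'a set \<Rightarrow> 'a set \<Rightarrow> bool" for R
  where
    single: "primeideal P R \<Longrightarrow> prime_chain R 0 P P"
  | step: "prime_chain R n P Q \<Longrightarrow> Q \<subset> Q' \<Longrightarrow> primeideal Q' R \<Longrightarrow> prime_chain R (Suc n) P Q'"

lemma prime_chain_Cons:
  "prime_chain R n Q Q' \<Longrightarrow> P \<subset> Q \<Longrightarrow> primeideal P R \<Longrightarrow> prime_chain R (Suc n) P Q'"
proof (induction rule: prime_chain.induct)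
  case (single Q)
  then show ?case using prime_chain.single prime_chain.step by blast
next
  case (step n Q Q' Q'')
  then show ?case using prime_chain.step by blast
qed

context module_over
begin

lemma diff_diff:
  assumes "p \<in> carrier N" "q \<in> carrier N" "s \<in> carrier N"
  shows "(p \<ominus>\<^bsub>N\<^esub> q) \<ominus>\<^bsub>N\<^esub> (p \<ominus>\<^bsub>N\<^esub> s) = s \<ominus>\<^bsub>N\<^esub> q"
    and "(p \<ominus>\<^bsub>N\<^esub> q) \<oplus>\<^bsub>N\<^esub> (q \<ominus>\<^bsub>N\<^esub> s) = p \<ominus>\<^bsub>N\<^esub> s"
proof -
  have "(p \<ominus>\<^bsub>N\<^esub> q) \<ominus>\<^bsub>N\<^esub> (p \<ominus>\<^bsub>N\<^esub> s) = (p \<oplus>\<^bsub>N\<^esub> \<ominus>\<^bsub>N\<^esub> p) \<oplus>\<^bsub>N\<^esub> (s \<ominus>\<^bsub>N\<^esub> q)"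
    using assms by (simp add: M.minus_eq M.minus_add M.a_ac)
  then show "(p \<ominus>\<^bsub>N\<^esub> q) \<ominus>\<^bsub>N\<^esub> (p \<ominus>\<^bsub>N\<^esub> s) = s \<ominus>\<^bsub>N\<^esub> q"
    using assms by (simp add: M.r_neg)
  have "(p \<ominus>\<^bsub>N\<^esub> q) \<oplus>\<^bsub>N\<^esub> (q \<ominus>\<^bsub>N\<^esub> s) = (q \<oplus>\<^bsub>N\<^esub> \<ominus>\<^bsub>N\<^esub> q) \<oplus>\<^bsub>N\<^esub> (p \<ominus>\<^bsub>N\<^esub> s)"
    using assms by (simp add: M.minus_eq M.a_ac)
  then show "(p \<ominus>\<^bsub>N\<^esub> q) \<oplus>\<^bsub>N\<^esub> (q \<ominus>\<^bsub>N\<^esub> s) = p \<ominus>\<^bsub>N\<^esub> s"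
    using assms by (simp add: M.r_neg)
qed

lemma smult_r_diff:
  assumes "r \<in> carrier R" "u \<in> carrier N" "v \<in> carrier N"
  shows "r \<odot>\<^bsub>N\<^esub> (u \<ominus>\<^bsub>N\<^esub> v) = r \<odot>\<^bsub>N\<^esub> u \<ominus>\<^bsub>N\<^esub> r \<odot>\<^bsub>N\<^esub> v"
  using assms by (simp add: M.minus_eq smult_r_distr smult_r_minus)

lemma mem_mult_sum_iff:
  assumes "x \<in> carrier R" "sub A" "sub B" "u \<in> carrier N"
  shows "u \<in> mult_sum N x A B \<longleftrightarrow> (\<exists>a\<in>A. u \<ominus>\<^bsub>N\<^esub> x \<odot>\<^bsub>N\<^esub> a \<in> B)"
proof
  assume "u \<in> mult_sum N x A B"
  then obtain a b where ab: "a \<in> A" "b \<in> B" "u = x \<odot>\<^bsub>N\<^esub> a \<oplus>\<^bsub>N\<^esub> b" by (rule mult_sumE)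
  then have N: "a \<in> carrier N" "b \<in> carrier N" using assms sub_carrier by blast+
  have "u \<ominus>\<^bsub>N\<^esub> x \<odot>\<^bsub>N\<^esub> a = b"
    using assms(1) ab(3) N by (simp add: M.minus_eq M.a_comm[of _ b] M.a_assoc M.r_neg)
  then have "u \<ominus>\<^bsub>N\<^esub> x \<odot>\<^bsub>N\<^esub> a \<in> B" using ab(2) by (simp only:)
  with ab(1) show "\<exists>a\<in>A. u \<ominus>\<^bsub>N\<^esub> x \<odot>\<^bsub>N\<^esub> a \<in> B" by blast
next
  assume "\<exists>a\<in>A. u \<ominus>\<^bsub>N\<^esub> x \<odot>\<^bsub>N\<^esub> a \<in> B"
  then obtain a where a: "a \<in> A" "u \<ominus>\<^bsub>N\<^esub> x \<odot>\<^bsub>N\<^esub> a \<in> B" by blast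
  have N: "a \<in> carrier N" using a assms sub_carrier by blast
  have "u = x \<odot>\<^bsub>N\<^esub> a \<oplus>\<^bsub>N\<^esub> (u \<ominus>\<^bsub>N\<^esub> x \<odot>\<^bsub>N\<^esub> a)"
    using assms N by (simp add: M.minus_eq M.a_comm[of u] M.r_neg2)
  then show "u \<in> mult_sum N x A B" using mult_sumI[OF a, of x] by simp
qed

lemma diff_swap:
  assumes "sub B" "p \<in> carrier N" "q \<in> carrier N" "p \<ominus>\<^bsub>N\<^esub> q \<in> B"
  shows "q \<ominus>\<^bsub>N\<^esub> p \<in> B"
proof -
  have "\<ominus>\<^bsub>N\<^esub> (p \<ominus>\<^bsub>N\<^esub> q) = q \<ominus>\<^bsub>N\<^esub> p"
    using assms by (simp add: M.minus_eq M.minus_add M.a_comm)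
  with sub_neg[OF assms(1,4)] show ?thesis by simp
qed

text \<open>Suppose \<open>x u = z v\<close> modulo \<open>B\<close>. As \<open>z\<close> is regular
  modulo \<open>x\<close>, \<open>v = x w\<close>, and cancelling \<open>x\<close> from
  \<open>x u = x z w\<close> gives \<open>u = z w\<close>, all modulo \<open>B\<close>.\<close>

lemma regular_on_permute:
  assumes x: "x \<in> carrier R" and z: "z \<in> carrier R" and A: "sub A" and B: "sub B"
    and rx: "regular_on N x A B" and rz: "regular_on N z A (mult_sum N x A B)"
  shows "regular_on N x A (mult_sum N z A B)"
  unfolding regular_on_def
proof (intro ballI impI)
  note cA = sub_carrier[OF A]
  fix u assume u: "u \<in> A" "x \<odot>\<^bsub>N\<^esub> u \<in> mult_sum N z A B"
  have xu: "x \<odot>\<^bsub>N\<^esub> u \<in> carrier N" using x u cA by simp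
  then obtain v where v: "v \<in> A" "x \<odot>\<^bsub>N\<^esub> u \<ominus>\<^bsub>N\<^esub> z \<odot>\<^bsub>N\<^esub> v \<in> B"
    using u mem_mult_sum_iff[OF z A B] by blast
  have zv: "z \<odot>\<^bsub>N\<^esub> v \<in> carrier N" using z v cA by simp
  have "z \<odot>\<^bsub>N\<^esub> v \<in> mult_sum N x A B"
    using diff_swap[OF B xu zv v(2)] u(1) mem_mult_sum_iff[OF x A B zv] by blast
  then have "v \<in> mult_sum N x A B" using rz v(1) by (simp add: regular_on_def)
  then obtain w where w: "w \<in> A" "v \<ominus>\<^bsub>N\<^esub> x \<odot>\<^bsub>N\<^esub> w \<in> B"
    using mem_mult_sum_iff[OF x A B] cA v(1) by blast
  have "x \<odot>\<^bsub>N\<^esub> (u \<ominus>\<^bsub>N\<^esub> z \<odot>\<^bsub>N\<^esub> w)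
      = (x \<odot>\<^bsub>N\<^esub> u \<ominus>\<^bsub>N\<^esub> z \<odot>\<^bsub>N\<^esub> v) \<oplus>\<^bsub>N\<^esub> z \<odot>\<^bsub>N\<^esub> (v \<ominus>\<^bsub>N\<^esub> x \<odot>\<^bsub>N\<^esub> w)"
    using x z cA[OF u(1)] cA[OF v(1)] cA[OF w(1)]
    by (simp add: smult_r_diff diff_diff(2) smult_comm[of z x])
  also have "\<dots> \<in> B" using sub_add[OF B v(2)] sub_smult[OF B z w(2)] by blast
  finally have "u \<ominus>\<^bsub>N\<^esub> z \<odot>\<^bsub>N\<^esub> w \<in> B"
    using rx sub_diff[OF A u(1)] sub_smult[OF A z w(1)] by (simp add: regular_on_def)
  then show "u \<in> mult_sum N z A B" using mem_mult_sum_iff[OF z A B] cA[OF u(1)] w(1) by blast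
qed

end

section \<open>Depth bounds and their independence of the chosen regular element\<close>

locale noetherian_local_module = noetherian_module R N + noetherian_local_ring R M
  for R (structure) and N (structure) and M
begin

text \<open>Elements outside \<open>M\<close> are units, so saturating at \<open>M\<close> adds
  nothing and the localized version applies with \<open>P = M\<close>.\<close>

lemma nakayama:
  assumes x: "x \<in> M" and H: "sub H" and K: "sub K" and HK: "H \<subseteq> mult_sum N x H K"
  shows "H \<subseteq> K"
proof -
  have xR: "x \<in> carrier R" using x by (rule maximal_subset_carrier)
  have "H \<subseteq> saturation R N M K"
    using HK saturation_upper[OF primeideal_maximal sub_mult_sum[OF xR H K]]
    by (intro nakayama_saturation[OF primeideal_maximal x H K]) blast
  moreover have "saturation R N M K \<subseteq> K"
  proof
    fix u assume "u \<in> saturation R N M K"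
    then obtain s where s: "u \<in> carrier N" "s \<in> carrier R" "s \<notin> M" "s \<odot>\<^bsub>N\<^esub> u \<in> K"
      by (auto simp: saturation_def)
    obtain t where t: "t \<in> carrier R" "t \<otimes>\<^bsub>R\<^esub> s = \<one>\<^bsub>R\<^esub>"
      using invertible_outside_maximal[OF s(2,3)] by blast
    have "t \<odot>\<^bsub>N\<^esub> (s \<odot>\<^bsub>N\<^esub> u) = u" using s t by (simp flip: smult_assoc1)
    then show "u \<in> K" using sub_smult[OF K t(1) s(4)] by simp
  qed
  ultimately show ?thesis by blast
qed

text \<open>For \<open>B\<close> inside \<open>A\<close> this is the vanishing of
  \<open>Hom (R/M, A/B)\<close>. By the next two lemmas it is equivalent to the existence of an
  element of \<open>M\<close> regular on \<open>A / B\<close>, but it names no element.\<close>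

definition no_socle :: "'c set \<Rightarrow> 'c set \<Rightarrow> bool"
  where "no_socle A B \<longleftrightarrow> (\<forall>u\<in>A. (\<forall>r\<in>M. r \<odot>\<^bsub>N\<^esub> u \<in> B) \<longrightarrow> u \<in> B)"

lemma regular_on_no_socle: "x \<in> M \<Longrightarrow> regular_on N x A B \<Longrightarrow> no_socle A B"
  by (auto simp: no_socle_def regular_on_def)

text \<open>If \<open>M\<close> were inside a maximal annihilator \<open>(B : u)\<close>, the class
  of \<open>u\<close> would be a nonzero socle element. So \<open>M\<close> is contained in none of
  the finitely many maximal annihilators of all the pairs together, and prime avoidance gives a
  single \<open>x\<close> for every pair.\<close>

lemma common_regular_element:
  assumes "finite \<A>" and \<A>: "\<And>A B. (A, B) \<in> \<A> \<Longrightarrow> sub A \<and> sub B \<and> no_socle A B"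
  shows "\<exists>x\<in>M. \<forall>(A, B)\<in>\<A>. regular_on N x A B"
proof -
  let ?F = "\<Union>(A, B)\<in>\<A>. maximal_annihilators A B"
  have "finite ?F" using assms finite_maximal_annihilators by auto
  moreover have "primeideal P R" if "P \<in> ?F" for P
    using that \<A> maximal_annihilator_prime by blast
  moreover have "ideal M R" using maximal by (rule maximalideal.axioms)
  moreover have "\<not> M \<subseteq> P" if "P \<in> ?F" for P
  proof
    assume MP: "M \<subseteq> P"
    obtain A B where AB: "(A, B) \<in> \<A>" "P \<in> maximal_annihilators A B" using \<open>P \<in> ?F\<close> by blast
    then obtain u where u: "u \<in> A" "u \<notin> B" "P = colon R N B {u}"
      by (auto simp: maximal_annihilators_def)
    have "\<forall>r\<in>M. r \<odot>\<^bsub>N\<^esub> u \<in> B" using subsetD[OF MP] by (simp add: u(3) colon_iff)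
    then show False using \<A>[OF AB(1)] u(1,2) by (simp add: no_socle_def)
  qed
  ultimately obtain x where x: "x \<in> M" "\<And>P. P \<in> ?F \<Longrightarrow> x \<notin> P"
    using R.prime_avoidance[of ?F M] by metis
  have "regular_on N x A B" if AB: "(A, B) \<in> \<A>" for A B
    unfolding regular_on_def
  proof (intro ballI impI)
    fix u assume u: "u \<in> A" "x \<odot>\<^bsub>N\<^esub> u \<in> B"
    show "u \<in> B"
    proof (rule ccontr)
      assume "u \<notin> B"
      then obtain P where P: "P \<in> maximal_annihilators A B" "colon R N B {u} \<subseteq> P"
        using maximal_annihilator_above[of A B u] \<A>[OF AB] u(1) by blast
      have "x \<in> colon R N B {u}" using u x(1) maximal_subset_carrier by (simp add: colon_iff)
      then show False using P x(2) AB by blast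
    qed
  qed
  with x(1) show ?thesis by blast
qed

text \<open>An elementary form of the fact that \<open>Hom (k, C / x C)\<close> is
  \<open>Ext^1 (k, C)\<close> for every \<open>x\<close> in \<open>M\<close> regular on
  \<open>C = A / B\<close>, where \<open>k = R/M\<close>. For a socle element \<open>u\<close>
  modulo \<open>y\<close>, write \<open>x u = y v\<close> modulo \<open>B\<close>; then
  \<open>v\<close> is a socle element modulo \<open>x\<close>, and \<open>v = x a\<close> yields
  \<open>u = y a\<close>.\<close>

lemma no_socle_change_element:
  assumes x: "x \<in> M" and y: "y \<in> M" and A: "sub A" and B: "sub B"
    and rx: "regular_on N x A B" and ry: "regular_on N y A B"
    and ns: "no_socle A (mult_sum N x A B)"
  shows "no_socle A (mult_sum N y A B)"
  unfolding no_socle_def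
proof (intro ballI impI)
  note cA = sub_carrier[OF A]
  note xR = maximal_subset_carrier[OF x] and yR = maximal_subset_carrier[OF y]
  fix u assume u: "u \<in> A" "\<forall>r\<in>M. r \<odot>\<^bsub>N\<^esub> u \<in> mult_sum N y A B"
  have uN: "u \<in> carrier N" using u cA by blast
  obtain v where v: "v \<in> A" "x \<odot>\<^bsub>N\<^esub> u \<ominus>\<^bsub>N\<^esub> y \<odot>\<^bsub>N\<^esub> v \<in> B"
    using mem_mult_sum_iff[OF yR A B, of "x \<odot>\<^bsub>N\<^esub> u"] u x xR uN by auto
  have vN: "v \<in> carrier N" using v cA by blast
  have "r \<odot>\<^bsub>N\<^esub> v \<in> mult_sum N x A B" if r: "r \<in> M" for r
  proof -
    note rR = maximal_subset_carrier[OF r]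
    obtain w where w: "w \<in> A" "r \<odot>\<^bsub>N\<^esub> u \<ominus>\<^bsub>N\<^esub> y \<odot>\<^bsub>N\<^esub> w \<in> B"
      using mem_mult_sum_iff[OF yR A B, of "r \<odot>\<^bsub>N\<^esub> u"] u r rR uN by auto
    have wN: "w \<in> carrier N" using w cA by blast
    have "y \<odot>\<^bsub>N\<^esub> (r \<odot>\<^bsub>N\<^esub> v \<ominus>\<^bsub>N\<^esub> x \<odot>\<^bsub>N\<^esub> w)
        = x \<odot>\<^bsub>N\<^esub> (r \<odot>\<^bsub>N\<^esub> u \<ominus>\<^bsub>N\<^esub> y \<odot>\<^bsub>N\<^esub> w) \<ominus>\<^bsub>N\<^esub> r \<odot>\<^bsub>N\<^esub> (x \<odot>\<^bsub>N\<^esub> u \<ominus>\<^bsub>N\<^esub> y \<odot>\<^bsub>N\<^esub> v)"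
      using xR yR rR uN vN wN
      by (simp add: smult_r_diff smult_comm[of r x] smult_comm[of y r] smult_comm[of y x] diff_diff(1))
    also have "\<dots> \<in> B"
      using sub_diff[OF B sub_smult[OF B xR w(2)] sub_smult[OF B rR v(2)]] .
    finally have "r \<odot>\<^bsub>N\<^esub> v \<ominus>\<^bsub>N\<^esub> x \<odot>\<^bsub>N\<^esub> w \<in> B"
      using ry sub_diff[OF A sub_smult[OF A rR v(1)] sub_smult[OF A xR w(1)]]
      by (simp add: regular_on_def)
    then show ?thesis using mem_mult_sum_iff[OF xR A B, of "r \<odot>\<^bsub>N\<^esub> v"] rR vN w(1) by auto
  qed
  then have "v \<in> mult_sum N x A B" using ns v(1) by (simp add: no_socle_def)
  then obtain a where a: "a \<in> A" "v \<ominus>\<^bsub>N\<^esub> x \<odot>\<^bsub>N\<^esub> a \<in> B"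
    using mem_mult_sum_iff[OF xR A B vN] by blast
  have aN: "a \<in> carrier N" using a cA by blast
  have "x \<odot>\<^bsub>N\<^esub> (u \<ominus>\<^bsub>N\<^esub> y \<odot>\<^bsub>N\<^esub> a)
      = (x \<odot>\<^bsub>N\<^esub> u \<ominus>\<^bsub>N\<^esub> y \<odot>\<^bsub>N\<^esub> v) \<oplus>\<^bsub>N\<^esub> y \<odot>\<^bsub>N\<^esub> (v \<ominus>\<^bsub>N\<^esub> x \<odot>\<^bsub>N\<^esub> a)"
    using xR yR uN vN aN by (simp add: smult_r_diff smult_comm[of y x] diff_diff(2))
  also have "\<dots> \<in> B" using sub_add[OF B v(2) sub_smult[OF B yR a(2)]] .
  finally have "u \<ominus>\<^bsub>N\<^esub> y \<odot>\<^bsub>N\<^esub> a \<in> B"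
    using rx sub_diff[OF A u(1) sub_smult[OF A yR a(1)]] by (simp add: regular_on_def)
  then show "u \<in> mult_sum N y A B" using mem_mult_sum_iff[OF yR A B uN] a(1) by blast
qed

text \<open>\<open>depth_ge n A B\<close> says that the subquotient \<open>A / B\<close> is zero or has depth at least \<open>n\<close>.\<close>

primrec depth_ge :: "nat \<Rightarrow> 'c set \<Rightarrow> 'c set \<Rightarrow> bool"
  where
    "depth_ge 0 A B \<longleftrightarrow> True"
  | "depth_ge (Suc n) A B \<longleftrightarrow> (\<exists>x\<in>M. regular_on N x A B \<and> depth_ge n A (mult_sum N x A B))"

text \<open>The socle vanishes modulo \<open>x\<close>, hence modulo \<open>y\<close>, so some
  \<open>z\<close> is regular on \<open>A / B\<close> and modulo either. Working modulo
  \<open>x\<close>, induction replaces the next element by \<open>z\<close>; after exchanging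
  \<open>x\<close> and \<open>z\<close>, induction modulo \<open>z\<close> replaces \<open>x\<close>
  by \<open>y\<close>; exchanging back puts \<open>z\<close> after \<open>y\<close>.\<close>

lemma depth_ge_change_element:
  assumes A: "sub A"
  shows "\<lbrakk>x \<in> M; y \<in> M; sub B; regular_on N x A B; regular_on N y A B;
    depth_ge n A (mult_sum N x A B)\<rbrakk> \<Longrightarrow> depth_ge n A (mult_sum N y A B)"
proof (induction n arbitrary: B x y)
  case 0 then show ?case by simp
next
  case (Suc n)
  note xR = maximal_subset_carrier[OF Suc.prems(1)] and yR = maximal_subset_carrier[OF Suc.prems(2)]
  let ?xA = "mult_sum N x A B" and ?yA = "mult_sum N y A B"
  note B = Suc.prems(3)
  have xA: "sub ?xA" and yA: "sub ?yA" using xR yR A B by (simp_all add: sub_mult_sum)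
  obtain z' where z': "z' \<in> M" "regular_on N z' A ?xA" "depth_ge n A (mult_sum N z' A ?xA)"
    using Suc.prems(6) by auto
  have nsx: "no_socle A ?xA" using regular_on_no_socle[OF z'(1,2)] .
  have nsy: "no_socle A ?yA" using no_socle_change_element[OF Suc.prems(1,2) A Suc.prems(3-5) nsx] .
  have nsB: "no_socle A B" using regular_on_no_socle[OF Suc.prems(1,4)] .
  obtain z where z: "z \<in> M" "regular_on N z A B" "regular_on N z A ?xA" "regular_on N z A ?yA"
    using common_regular_element[of "{(A, B), (A, ?xA), (A, ?yA)}"] A B xA yA nsx nsy nsB by auto
  note zR = maximal_subset_carrier[OF z(1)]
  have zA: "sub (mult_sum N z A B)" using zR A B by (simp add: sub_mult_sum)
  have "depth_ge n A (mult_sum N z A ?xA)"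
    using Suc.IH[OF z'(1) z(1) xA z'(2) z(3) z'(3)] .
  then have *: "depth_ge n A (mult_sum N x A (mult_sum N z A B))"
    by (simp add: mult_sum_commute[OF zR xR A B])
  have "depth_ge n A (mult_sum N y A (mult_sum N z A B))"
    by (rule Suc.IH[OF Suc.prems(1,2) zA _ _ *])
      (use regular_on_permute[OF _ zR A B] xR yR Suc.prems(4,5) z in blast)+
  then have "depth_ge n A (mult_sum N z A ?yA)"
    by (simp add: mult_sum_commute[OF zR yR A B])
  with z show ?case by auto
qed

text \<open>\<open>depth_ge\<close> only supplies some regular \<open>y\<close>; this allows any
  \<open>x\<close>, in particular one chosen regular on several subquotients.\<close>

corollary depth_ge_regular:
  assumes "sub A" "sub B" "x \<in> M" "regular_on N x A B" "depth_ge (Suc n) A B"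
  shows "depth_ge n A (mult_sum N x A B)"
proof -
  obtain y where "y \<in> M" "regular_on N y A B" "depth_ge n A (mult_sum N y A B)"
    using assms(5) by auto
  with assms show ?thesis using depth_ge_change_element by blast
qed

text \<open>The isomorphism of \<open>A / (A \<inter> K)\<close> with \<open>(A + K) / K\<close> is
  carried through the recursion one regular element at a time: with
  \<open>K' = x (A + K) + K\<close>, one has \<open>A \<inter> K' = x A + (A \<inter> K)\<close> and
  \<open>A + K' = A + K\<close>.\<close>

lemma depth_ge_second_iso:
  assumes A: "sub A"
  shows "\<lbrakk>sub K; depth_ge n A (A \<inter> K)\<rbrakk> \<Longrightarrow> depth_ge n (A <+>\<^bsub>N\<^esub> K) K"
proof (induction n arbitrary: K)
  case 0 then show ?case by simp
next
  case (Suc n)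
  note K = Suc.prems(1) and cA = sub_carrier[OF A] and cK = sub_carrier[OF Suc.prems(1)]
  obtain x where x: "x \<in> M" "regular_on N x A (A \<inter> K)" "depth_ge n A (mult_sum N x A (A \<inter> K))"
    using Suc.prems(2) by auto
  note xR = maximal_subset_carrier[OF x(1)]
  let ?K = "mult_sum N x (A <+>\<^bsub>N\<^esub> K) K"
  have AK: "sub (A <+>\<^bsub>N\<^esub> K)" using A K by (rule sub_set_add)
  have K': "sub ?K" using xR AK K by (rule sub_mult_sum)
  have up: "A \<subseteq> A <+>\<^bsub>N\<^esub> K" "K \<subseteq> A <+>\<^bsub>N\<^esub> K" using set_add_upper[OF A K] by auto
  have upK: "K \<subseteq> ?K" "\<And>a. a \<in> A <+>\<^bsub>N\<^esub> K \<Longrightarrow> x \<odot>\<^bsub>N\<^esub> a \<in> ?K"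
    using mult_sum_upper[OF xR AK K] by auto
  have xAK: "x \<odot>\<^bsub>N\<^esub> (a \<oplus>\<^bsub>N\<^esub> k) = x \<odot>\<^bsub>N\<^esub> a \<oplus>\<^bsub>N\<^esub> x \<odot>\<^bsub>N\<^esub> k" if "a \<in> A" "k \<in> K" for a k
    using that cA cK xR by (simp add: smult_r_distr)
  have "regular_on N x (A <+>\<^bsub>N\<^esub> K) K"
    unfolding regular_on_def
  proof (intro ballI impI)
    fix u assume u: "u \<in> A <+>\<^bsub>N\<^esub> K" "x \<odot>\<^bsub>N\<^esub> u \<in> K"
    then obtain a k where ak: "a \<in> A" "k \<in> K" "u = a \<oplus>\<^bsub>N\<^esub> k" by (auto simp: set_add_iff)
    have "x \<odot>\<^bsub>N\<^esub> a \<in> K"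
      using sub_add_cancel[OF K, of "x \<odot>\<^bsub>N\<^esub> a" "x \<odot>\<^bsub>N\<^esub> k"] u(2) ak xAK cA xR sub_smult[OF K xR] by simp
    then have "a \<in> K" using x(2) ak(1) sub_smult[OF A xR] by (auto simp: regular_on_def)
    then show "u \<in> K" using sub_add[OF K] ak by blast
  qed
  moreover have "mult_sum N x A (A \<inter> K) = A \<inter> ?K"
  proof
    show "mult_sum N x A (A \<inter> K) \<subseteq> A \<inter> ?K"
      using up upK sub_smult[OF A xR] by (intro mult_sum_least sub_Int A K') auto
    show "A \<inter> ?K \<subseteq> mult_sum N x A (A \<inter> K)"
    proof
      fix b assume b: "b \<in> A \<inter> ?K"
      then obtain a k k' where *: "a \<in> A" "k \<in> K" "k' \<in> K" "b = x \<odot>\<^bsub>N\<^esub> (a \<oplus>\<^bsub>N\<^esub> k) \<oplus>\<^bsub>N\<^esub> k'"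
        by (auto simp: set_add_iff elim!: mult_sumE)
      have eq: "b = x \<odot>\<^bsub>N\<^esub> a \<oplus>\<^bsub>N\<^esub> (x \<odot>\<^bsub>N\<^esub> k \<oplus>\<^bsub>N\<^esub> k')"
        using * xAK cA cK xR by (simp add: M.a_assoc)
      have "x \<odot>\<^bsub>N\<^esub> k \<oplus>\<^bsub>N\<^esub> k' \<in> K" using * sub_add[OF K] sub_smult[OF K xR] by blast
      moreover from this have "x \<odot>\<^bsub>N\<^esub> k \<oplus>\<^bsub>N\<^esub> k' \<in> A"
        using sub_add_cancel'[OF A, of "x \<odot>\<^bsub>N\<^esub> a"] eq b * sub_smult[OF A xR] cK by auto
      ultimately show "b \<in> mult_sum N x A (A \<inter> K)" using eq mult_sumI * by blast
    qed
  qed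
  moreover have "A <+>\<^bsub>N\<^esub> ?K = A <+>\<^bsub>N\<^esub> K"
  proof
    show "A <+>\<^bsub>N\<^esub> ?K \<subseteq> A <+>\<^bsub>N\<^esub> K"
      using mult_sum_subset[OF xR AK up(2)] up(1) AK by (intro set_add_least)
    show "A <+>\<^bsub>N\<^esub> K \<subseteq> A <+>\<^bsub>N\<^esub> ?K"
      using set_add_upper[OF A K'] upK(1) sub_set_add[OF A K'] by (intro set_add_least) auto
  qed
  ultimately show ?case using Suc.IH[OF K'] x by auto
qed

text \<open>Choose \<open>z\<close> regular on \<open>A / B\<close> and on \<open>C / A\<close>,
  hence on \<open>C / B\<close>. Regularity on \<open>C / A\<close> keeps the sequence exact modulo
  \<open>z\<close>: \<open>A\<close> meets \<open>z C + B\<close> in \<open>z A + B\<close>, so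
  \<open>(z C + A) / (z C + B)\<close> is isomorphic to \<open>A / (z A + B)\<close>. The induction
  hypothesis applies to the triple \<open>z C + B\<close>, \<open>z C + A\<close>,
  \<open>C\<close>.\<close>

theorem depth_ge_extension:
  assumes C: "sub C"
  shows "\<lbrakk>sub A; sub B; B \<subseteq> A; A \<subseteq> C; depth_ge n A B; depth_ge n C A\<rbrakk> \<Longrightarrow> depth_ge n C B"
proof (induction n arbitrary: A B)
  case 0 then show ?case by simp
next
  case (Suc n)
  note A = Suc.prems(1) and B = Suc.prems(2)
  have "no_socle A B" "no_socle C A"
    using Suc.prems(5,6) regular_on_no_socle by auto
  then obtain z where z: "z \<in> M" "regular_on N z A B" "regular_on N z C A"
    using common_regular_element[of "{(A, B), (C, A)}"] A B C by auto
  note zR = maximal_subset_carrier[OF z(1)]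
  let ?K = "mult_sum N z C B"
  have K: "sub ?K" and CA: "sub (mult_sum N z C A)" and zA: "sub (mult_sum N z A B)"
    using zR A B C by (simp_all add: sub_mult_sum)
  note upK = mult_sum_upper[OF zR C B] and upCA = mult_sum_upper[OF zR C A]
  have rz: "regular_on N z C B"
    using z Suc.prems(3) by (auto simp: regular_on_def)
  have int: "A \<inter> ?K = mult_sum N z A B"
  proof
    show "mult_sum N z A B \<subseteq> A \<inter> ?K"
      using upK Suc.prems(3,4) sub_smult[OF A zR] by (intro mult_sum_least sub_Int A K) auto
    show "A \<inter> ?K \<subseteq> mult_sum N z A B"
    proof
      fix a assume a: "a \<in> A \<inter> ?K"
      then obtain c b where cb: "c \<in> C" "b \<in> B" "a = z \<odot>\<^bsub>N\<^esub> c \<oplus>\<^bsub>N\<^esub> b" by (auto elim: mult_sumE)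
      have "z \<odot>\<^bsub>N\<^esub> c \<in> A"
        using sub_add_cancel[OF A, of _ b] a cb Suc.prems(3) sub_carrier[OF C] zR by auto
      then have "c \<in> A" using z(3) cb(1) by (simp add: regular_on_def)
      then show "a \<in> mult_sum N z A B" using cb mult_sumI by blast
    qed
  qed
  have sum: "A <+>\<^bsub>N\<^esub> ?K = mult_sum N z C A"
  proof
    show "A <+>\<^bsub>N\<^esub> ?K \<subseteq> mult_sum N z C A"
      using upCA Suc.prems(3) by (intro set_add_least CA mult_sum_least) auto
    show "mult_sum N z C A \<subseteq> A <+>\<^bsub>N\<^esub> ?K"
      using set_add_upper[OF A K] upK by (intro mult_sum_least sub_set_add A K) auto
  qed
  have "depth_ge n A (A \<inter> ?K)"
    unfolding int using depth_ge_regular[OF A B z(1,2) Suc.prems(5)] .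
  then have "depth_ge n (mult_sum N z C A) ?K"
    using depth_ge_second_iso[OF A K] by (simp add: sum)
  moreover have "depth_ge n C (mult_sum N z C A)"
    using depth_ge_regular[OF C A z(1,3) Suc.prems(6)] .
  moreover have "?K \<subseteq> mult_sum N z C A"
    using upCA Suc.prems(3) by (intro mult_sum_least CA) auto
  moreover have "mult_sum N z C A \<subseteq> C"
    using mult_sum_subset[OF zR C Suc.prems(4)] .
  ultimately have "depth_ge n C ?K" using Suc.IH[OF CA K] by blast
  then show ?case using z(1) rz by auto
qed

text \<open>Nakayama shows that some element killed by \<open>P\<close> survives in \<open>A / (x A + B)\<close>; an
  associated prime above its annihilator contains \<open>P\<close> and \<open>x \<notin> P\<close>.\<close>

lemma annihilator_prime_step:
  assumes A: "sub A" and B: "sub B" and BA: "B \<subseteq> A" and x: "x \<in> M" "regular_on N x A B"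
    and P: "primeideal P R" and u: "u \<in> A" "P = colon R N B {u}"
  shows "\<exists>v\<in>A. primeideal (colon R N (mult_sum N x A B) {v}) R \<and>
    P \<subset> colon R N (mult_sum N x A B) {v}"
proof -
  interpret P: primeideal P R by fact
  note xR = maximal_subset_carrier[OF x(1)] and cA = sub_carrier[OF A]
  let ?K = "mult_sum N x A B"
  have K: "sub ?K" using xR A B by (rule sub_mult_sum)
  have "\<one>\<^bsub>R\<^esub> \<notin> P" using P.I_notcarr P.one_imp_carrier by auto
  then have uB: "u \<notin> B" using u cA by (auto simp: colon_iff)
  \<comment> \<open>\<open>H / B\<close> is the part of \<open>A / B\<close> killed by
    \<open>P\<close>; it contains the nonzero class of \<open>u\<close>.\<close>
  define H where "H = {w \<in> A. \<forall>r\<in>P. r \<odot>\<^bsub>N\<^esub> w \<in> B}"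
  have H: "sub H"
  proof (rule submoduleI)
    show "H \<subseteq> carrier N" using cA by (auto simp: H_def)
    show "\<zero>\<^bsub>N\<^esub> \<in> H" using sub_zero[OF A] sub_zero[OF B] P.a_Hcarr by (auto simp: H_def)
    fix v assume v: "v \<in> H"
    then have vA: "v \<in> A" "v \<in> carrier N" using cA by (simp_all add: H_def)
    show "\<ominus>\<^bsub>N\<^esub> v \<in> H"
      using v vA sub_neg[OF A] sub_neg[OF B] P.a_Hcarr by (auto simp: H_def smult_r_minus)
    { fix w assume w: "w \<in> H"
      then have "w \<in> A" "w \<in> carrier N" using cA by (simp_all add: H_def)
      then show "v \<oplus>\<^bsub>N\<^esub> w \<in> H"
        using v w vA sub_add[OF A] sub_add[OF B] P.a_Hcarr by (auto simp: H_def smult_r_distr) }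
    { fix a assume "a \<in> carrier R"
      then show "a \<odot>\<^bsub>N\<^esub> v \<in> H"
        using v vA sub_smult[OF A] sub_smult[OF B] P.a_Hcarr by (auto simp: H_def smult_comm[of _ a]) }
  qed
  have "\<not> H \<subseteq> ?K"
  proof
    assume HK: "H \<subseteq> ?K"
    have "H \<subseteq> mult_sum N x H B"
    proof
      fix w assume w: "w \<in> H"
      obtain a b where ab: "a \<in> A" "b \<in> B" "w = x \<odot>\<^bsub>N\<^esub> a \<oplus>\<^bsub>N\<^esub> b"
        using subsetD[OF HK w] by (rule mult_sumE)
      have N: "a \<in> carrier N" "b \<in> carrier N" using ab cA BA by auto
      \<comment> \<open>As \<open>P\<close> kills \<open>w = x a + b\<close> modulo
        \<open>B\<close>, regularity of \<open>x\<close> shows that it kills \<open>a\<close> as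
        well. Hence \<open>H\<close> is contained in \<open>x H + B\<close>.\<close>
      have "r \<odot>\<^bsub>N\<^esub> a \<in> B" if r: "r \<in> P" for r
      proof -
        note rR = P.a_Hcarr[OF r]
        have "x \<odot>\<^bsub>N\<^esub> (r \<odot>\<^bsub>N\<^esub> a) \<oplus>\<^bsub>N\<^esub> r \<odot>\<^bsub>N\<^esub> b = r \<odot>\<^bsub>N\<^esub> w"
          using ab(3) N rR xR by (simp add: smult_r_distr smult_comm)
        also have "\<dots> \<in> B" using w r by (simp add: H_def)
        finally have "x \<odot>\<^bsub>N\<^esub> (r \<odot>\<^bsub>N\<^esub> a) \<in> B"
          using sub_add_cancel[OF B] N rR xR sub_smult[OF B rR ab(2)] by simp
        then show ?thesis using x(2) sub_smult[OF A rR ab(1)] by (simp add: regular_on_def)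
      qed
      then have "a \<in> H" using ab(1) by (simp add: H_def)
      with ab show "w \<in> mult_sum N x H B" using mult_sumI by blast
    qed
    then have "H \<subseteq> B" by (rule nakayama[OF x(1) H B])
    moreover have "u \<in> H" using u by (auto simp: H_def colon_iff)
    ultimately show False using uB by blast
  qed
  then obtain w where w: "w \<in> H" "w \<notin> ?K" by blast
  have wA: "w \<in> A" using w by (simp add: H_def)
  obtain Q where Q: "Q \<in> maximal_annihilators A ?K" "colon R N ?K {w} \<subseteq> Q"
    using maximal_annihilator_above[OF A K wA w(2)] by blast
  note up = mult_sum_upper[OF xR A B]
  have "P \<subseteq> colon R N ?K {w}"
    using w(1) subsetD[OF up(1)] P.a_Hcarr by (simp add: subset_iff H_def colon_iff)
  with Q(2) have "P \<subseteq> Q" by blast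
  moreover have "x \<in> Q" using subsetD[OF Q(2), of x] up(2)[OF wA] xR by (simp add: colon_iff)
  moreover have "x \<notin> P" using x(2) u uB by (auto simp: colon_iff regular_on_def)
  ultimately have "P \<subset> Q" by blast
  moreover have "primeideal Q R" using maximal_annihilator_prime[OF A K Q(1)] .
  moreover obtain v where "v \<in> A" "Q = colon R N ?K {v}"
    using Q(1) by (auto simp: maximal_annihilators_def)
  ultimately show ?thesis by blast
qed

theorem depth_ge_prime_chain:
  assumes A: "sub A"
  shows "\<lbrakk>sub B; B \<subseteq> A; primeideal (colon R N B {u}) R; u \<in> A; depth_ge n A B\<rbrakk>
    \<Longrightarrow> \<exists>Q. prime_chain R n (colon R N B {u}) Q"
proof (induction n arbitrary: B u)
  case 0 then show ?case using prime_chain.single by blast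
next
  case (Suc n)
  obtain x where x: "x \<in> M" "regular_on N x A B" "depth_ge n A (mult_sum N x A B)"
    using Suc.prems(5) by auto
  note xR = maximal_subset_carrier[OF x(1)]
  obtain v where v: "v \<in> A" "primeideal (colon R N (mult_sum N x A B) {v}) R"
    "colon R N B {u} \<subset> colon R N (mult_sum N x A B) {v}"
    using annihilator_prime_step[OF A Suc.prems(1,2) x(1,2) Suc.prems(3,4) refl] by blast
  obtain Q where "prime_chain R n (colon R N (mult_sum N x A B) {v}) Q"
    using Suc.IH[OF sub_mult_sum[OF xR A Suc.prems(1)] mult_sum_subset[OF xR A Suc.prems(2)] v(2,1) x(3)]
    by blast
  then show ?case using prime_chain_Cons[OF _ v(3) Suc.prems(3)] by blast
qed

end

section \<open>Krull's principal ideal theorem and finite dimension\<close>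

lemma (in primeideal) power_mem:
  "a \<in> carrier R \<Longrightarrow> a [^] (n::nat) \<in> I \<Longrightarrow> a \<in> I"
proof (induction n)
  case 0 then show ?case using I_notcarr one_imp_carrier by simp
next
  case (Suc n) then show ?case using I_prime[of "a [^] n" a] by auto
qed

section \<open>Prime chains and the dimension of quotient rings\<close>

lemma prime_chain_primes: "prime_chain R n A B \<Longrightarrow> primeideal A R \<and> primeideal B R"
  by (induction rule: prime_chain.induct) auto

lemma prime_chain_subset: "prime_chain R n A B \<Longrightarrow> A \<subseteq> B \<and> (n > 0 \<longrightarrow> A \<subset> B)"
  by (induction rule: prime_chain.induct) auto

lemma prime_chain_iff_sequence:
  "prime_chain R n A B \<longleftrightarrow> (\<exists>P. (\<forall>i\<le>n. primeideal (P i) R) \<and> (\<forall>i<n. P i \<subset> P (Suc i)) \<and>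
     P 0 = A \<and> P n = B)" (is "_ \<longleftrightarrow> ?seq n B")
proof
  show "prime_chain R n A B \<Longrightarrow> ?seq n B"
  proof (induction rule: prime_chain.induct)
    case (single P)
    then show ?case by (intro exI[of _ "\<lambda>_. P"]) auto
  next
    case (step n P Q Q')
    then obtain f where "\<forall>i\<le>n. primeideal (f i) R" "\<forall>i<n. f i \<subset> f (Suc i)" "f 0 = P" "f n = Q"
      by blast
    with step show ?case
      by (intro exI[of _ "f(Suc n := Q')"]) (auto simp: le_Suc_eq less_Suc_eq)
  qed
  show "?seq n B \<Longrightarrow> prime_chain R n A B"
  proof (induction n arbitrary: B)
    case 0 then show ?case using prime_chain.single by auto
  next
    case (Suc n)
    then obtain P where P: "\<forall>i\<le>Suc n. primeideal (P i) R" "\<forall>i<Suc n. P i \<subset> P (Suc i)"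
      "P 0 = A" "P (Suc n) = B" by blast
    then have "prime_chain R n A (P n)" by (intro Suc.IH exI[of _ P]) auto
    with P show ?case using prime_chain.step[of R n A "P n" B] by auto
  qed
qed

text \<open>Elements of \<open>P\<close> are cosets of \<open>J\<close>, so their union is the
  preimage of \<open>P\<close> under the projection of \<open>R\<close> onto
  \<open>R / J\<close>.\<close>

lemma (in cring) primeideal_Union_quot:
  assumes J: "ideal J R" and P: "primeideal P (R Quot J)"
  shows "primeideal (\<Union>P) R" and "J \<subseteq> \<Union>P"
    and "\<Union>P = {r \<in> carrier R. J +> r \<in> P}"
proof -
  have P_ideal: "ideal P (R Quot J)" using P by (rule primeideal.axioms)
  interpret P: ideal P "R Quot J" by (rule P_ideal)
  show eq: "\<Union>P = {r \<in> carrier R. J +> r \<in> P}"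
    using canonical_proj_vimage_in_carrier[OF J P.a_subset]
      canonical_proj_vimage_mem_iff[OF J P.a_subset] by blast
  show "primeideal (\<Union>P) R"
    using ring_hom_ring.primeideal_vimage[OF ideal.rcos_ring_hom_ring[OF J] is_cring P] eq by simp
  have "\<zero>\<^bsub>R Quot J\<^esub> = J" by (simp add: FactRing_def)
  then have "J \<in> P" using additive_subgroup.zero_closed[OF ideal.axioms(1)[OF P_ideal]] by metis
  then show "J \<subseteq> \<Union>P" by blast
qed

lemma (in cring) primeideal_image_quot:
  assumes J: "ideal J R" and P: "primeideal P R" and JP: "J \<subseteq> P"
  shows "primeideal ((+>) J ` P) (R Quot J)" and "\<Union>((+>) J ` P) = P"
proof -
  interpret P: primeideal P R by fact
  have id: "ideal ((+>) J ` P) (R Quot J)" using ring_ideal_imp_quot_ideal[OF J P.is_ideal] .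
  show U: "\<Union>((+>) J ` P) = P" using ideal_incl_iff[OF J P.is_ideal] JP by simp
  have mem: "J +> r \<in> (+>) J ` P \<longleftrightarrow> r \<in> P" if "r \<in> carrier R" for r
    using canonical_proj_vimage_mem_iff[OF J additive_subgroup.a_subset[OF ideal.axioms(1)[OF id]] that] U
    by simp
  show "primeideal ((+>) J ` P) (R Quot J)"
  proof (rule primeidealI[OF id])
    show "cring (R Quot J)" using ideal.quotient_is_cring[OF J is_cring] .
    have "J +> \<one> \<notin> (+>) J ` P" using mem[OF one_closed] P.I_notcarr P.one_imp_carrier by auto
    then show "carrier (R Quot J) \<noteq> (+>) J ` P"
      by (auto simp: FactRing_def A_RCOSETS_def')
    fix a b assume "a \<in> carrier (R Quot J)" "b \<in> carrier (R Quot J)"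
      and ab: "a \<otimes>\<^bsub>R Quot J\<^esub> b \<in> (+>) J ` P"
    then obtain r s where rs: "r \<in> carrier R" "s \<in> carrier R" "a = J +> r" "b = J +> s"
      by (auto simp: FactRing_def A_RCOSETS_def')
    then have "J +> (r \<otimes> s) \<in> (+>) J ` P"
      using ab ideal.rcoset_mult_add[OF J rs(1,2)] by (simp add: FactRing_def)
    then have "r \<otimes> s \<in> P" using mem rs by simp
    then show "a \<in> (+>) J ` P \<or> b \<in> (+>) J ` P" using P.I_prime rs by blast
  qed
qed

lemma (in cring) prime_chain_quot_iff:
  assumes J: "ideal J R"
  shows "(\<exists>P :: nat \<Rightarrow> 'a set set. (\<forall>i\<le>n. primeideal (P i) (R Quot J)) \<and> (\<forall>i<n. P i \<subset> P (Suc i)))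
    \<longleftrightarrow> (\<exists>A B. J \<subseteq> A \<and> prime_chain R n A B)"
proof
  assume "\<exists>P :: nat \<Rightarrow> 'a set set. (\<forall>i\<le>n. primeideal (P i) (R Quot J)) \<and> (\<forall>i<n. P i \<subset> P (Suc i))"
  then obtain P :: "nat \<Rightarrow> 'a set set"
    where P: "\<And>i. i \<le> n \<Longrightarrow> primeideal (P i) (R Quot J)" "\<And>i. i < n \<Longrightarrow> P i \<subset> P (Suc i)" by blast
  note U = primeideal_Union_quot[OF J P(1)]
  have "\<Union>(P i) \<subset> \<Union>(P (Suc i))" if i: "i < n" for i
  proof -
    have "P i \<subseteq> carrier (R Quot J)" "P (Suc i) \<subseteq> carrier (R Quot J)"
      using P(1)[of i] P(1)[of "Suc i"] i primeideal.axioms(1) ideal.axioms(1)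
        additive_subgroup.a_subset by (metis less_or_eq_imp_le Suc_leI)+
    moreover obtain C where C: "C \<in> P (Suc i)" "C \<notin> P i" using P(2)[OF i] by blast
    ultimately obtain r where "r \<in> carrier R" "C = J +> r"
      by (auto simp: FactRing_def A_RCOSETS_def')
    with C have "r \<in> carrier R" "J +> r \<in> P (Suc i)" "J +> r \<notin> P i" by auto
    then have "r \<in> \<Union>(P (Suc i))" "r \<notin> \<Union>(P i)" using U(3) i by auto
    moreover have "\<Union>(P i) \<subseteq> \<Union>(P (Suc i))" using P(2)[OF i] by blast
    ultimately show ?thesis by blast
  qed
  then have "prime_chain R n (\<Union>(P 0)) (\<Union>(P n))"
    unfolding prime_chain_iff_sequence using U(1) by (intro exI[of _ "\<lambda>i. \<Union>(P i)"]) auto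
  then show "\<exists>A B. J \<subseteq> A \<and> prime_chain R n A B" using U(2)[of 0] by blast
next
  assume "\<exists>A B. J \<subseteq> A \<and> prime_chain R n A B"
  then obtain P where P: "\<And>i. i \<le> n \<Longrightarrow> primeideal (P i) R" "\<And>i. i < n \<Longrightarrow> P i \<subset> P (Suc i)" "J \<subseteq> P 0"
    unfolding prime_chain_iff_sequence by blast
  have JP: "J \<subseteq> P i" if "i \<le> n" for i
    using that
  proof (induction i)
    case (Suc i) then show ?case using P(2)[of i] by auto
  qed (use P in simp)
  note Q = primeideal_image_quot[OF J P(1) JP]
  show "\<exists>P :: nat \<Rightarrow> 'a set set. (\<forall>i\<le>n. primeideal (P i) (R Quot J)) \<and> (\<forall>i<n. P i \<subset> P (Suc i))"
  proof (intro exI[of _ "\<lambda>i. (+>) J ` P i"] conjI allI impI)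
    fix i assume i: "i < n"
    have "\<Union>((+>) J ` P i) = P i" "\<Union>((+>) J ` P (Suc i)) = P (Suc i)"
      using i by (intro Q(2); simp)+
    then have "(+>) J ` P i \<noteq> (+>) J ` P (Suc i)" using P(2)[OF i] by (metis psubset_eq)
    with P(2)[OF i] show "(+>) J ` P i \<subset> (+>) J ` P (Suc i)" by blast
  next
    fix i assume "i \<le> n"
    then show "primeideal ((+>) J ` P i) (R Quot J)" by (intro Q(1))
  qed
qed

text \<open>Later dimension arguments use chains of primes of \<open>R\<close> above
  \<open>J\<close> instead of chains in \<open>R / J\<close>. If \<open>J\<close> is the whole ring
  there are none, in accordance with dimension \<open>-\<infinity>\<close>.\<close>

lemma (in cring) krull_dim_quot_le_iff:
  assumes "ideal J R"
  shows "krull_dim (R Quot J) \<le> c \<longleftrightarrow> (\<forall>n A B. J \<subseteq> A \<longrightarrow> prime_chain R n A B \<longrightarrow> ereal (real n) \<le> c)"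
  unfolding krull_dim_def prime_chain_quot_iff[OF assms] Sup_le_iff by blast

lemma (in cring) krull_dim_quot_ge:
  assumes "ideal J R" "J \<subseteq> A" "prime_chain R n A B"
  shows "ereal (real n) \<le> krull_dim (R Quot J)"
  using krull_dim_quot_le_iff[OF assms(1), THEN iffD1, OF order_refl] assms(2,3) by blast

section \<open>The principal ideal theorem by saturation at a prime\<close>

locale noetherian_cring = noetherian_ring R + cring R for R (structure)
begin

abbreviation "sat \<equiv> saturation R (ring_module R)"

lemma noetherian_module: "noetherian_module R (ring_module R)"
  by (rule noetherian_module_ring_module) unfold_locales

definition saturated_dcc :: "'a set \<Rightarrow> 'a set \<Rightarrow> bool"
  where "saturated_dcc P I \<longleftrightarrow> (\<forall>f. (\<forall>n::nat. ideal (f n) R \<and> sat P (f n) \<subseteq> f n \<and> I \<subseteq> f n \<and> f (Suc n) \<subseteq> f n)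
    \<longrightarrow> (\<exists>n. \<forall>m\<ge>n. f m = f n))"

text \<open>In the language of localization: \<open>R\<^sub>P / I R\<^sub>P\<close> is Artinian when \<open>P\<close> is minimal over \<open>I\<close>.
  A maximal counterexample \<open>I\<close> has some \<open>v \<notin> I\<close> with \<open>(I : v) = P\<close>, so there is no saturated
  ideal strictly between \<open>I\<close> and the saturation of \<open>I + R v\<close>.\<close>

lemma saturated_dcc_minimal_prime:
  assumes P: "primeideal P R" and min: "\<And>Q. primeideal Q R \<Longrightarrow> I0 \<subseteq> Q \<Longrightarrow> Q \<subseteq> P \<Longrightarrow> Q = P"
    and I: "ideal I R" "sat P I \<subseteq> I" "I0 \<subseteq> I"
  shows "saturated_dcc P I"
proof (rule ccontr)
  assume bad: "\<not> saturated_dcc P I"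
  interpret N: noetherian_module R "ring_module R" by (rule noetherian_module)
  note sub_iff = submodule_ring_module_iff
  let ?V = "{I. ideal I R \<and> sat P I \<subseteq> I \<and> I0 \<subseteq> I \<and> \<not> saturated_dcc P I}"
  have "\<exists>J\<in>?V. \<forall>K\<in>?V. J \<subseteq> K \<longrightarrow> K = J"
    using I bad by (intro maximal_ideal_exists) auto
  then obtain J where JV: "J \<in> ?V" and max: "\<forall>K\<in>?V. J \<subseteq> K \<longrightarrow> K = J"
    by (rule bexE) (rule that)
  then have J: "ideal J R" "sat P J \<subseteq> J" "I0 \<subseteq> J" "\<not> saturated_dcc P J" by auto
  have sJ: "N.sub J" using J(1) sub_iff by simp
  interpret J: ideal J R by fact
  obtain f where f: "\<And>n. ideal (f n) R" "\<And>n. sat P (f n) \<subseteq> f n" "\<And>n. J \<subseteq> f n" "\<And>n. f (Suc n) \<subseteq> f n"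
    and unstable: "\<not> (\<exists>n. \<forall>m\<ge>n. f m = f n)"
    using J(4) unfolding saturated_dcc_def by blast
  have sf: "N.sub (f n)" for n using f(1) sub_iff by simp
  have anti: "f m \<subseteq> f n" if "n \<le> m" for m n
    using lift_Suc_antimono_le[of f] f(4) that by blast
  have fc: "f n \<subseteq> carrier R" for n using N.sub_carrier[OF sf] by auto
  have "J \<noteq> carrier R" using unstable f(3) fc by (metis subset_antisym)
  then obtain u where u: "u \<in> carrier R" "u \<notin> J" using J.a_subset by blast
  obtain Q where Q: "Q \<in> N.maximal_annihilators (carrier R) J"
    using N.maximal_annihilator_above[OF N.carrier_is_submodule sJ] u by auto
  then obtain v where v: "v \<in> carrier R" "v \<notin> J" "Q = colon R (ring_module R) J {v}"
    by (auto simp: N.maximal_annihilators_def)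
  have Q: "primeideal (colon R (ring_module R) J {v}) R"
    using N.maximal_annihilator_prime[OF N.carrier_is_submodule sJ] Q v(3) by auto
  have "J \<subseteq> colon R (ring_module R) J {v}"
    using v J.a_subset J.I_r_closed by (auto simp: N.colon_iff)
  moreover have "colon R (ring_module R) J {v} \<subseteq> P"
  proof
    fix s assume s: "s \<in> colon R (ring_module R) J {v}"
    show "s \<in> P"
    proof (rule ccontr)
      assume "s \<notin> P"
      then have "v \<in> sat P J" using s v by (auto simp: N.colon_iff saturation_def)
      then show False using J(2) v by blast
    qed
  qed
  ultimately have colon_eq: "colon R (ring_module R) J {v} = P" using min[OF Q] J(3) by blast
  \<comment> \<open>For an ideal \<open>H\<close>, the smallest \<open>P\<close>-saturated ideal
    containing \<open>H\<close> and \<open>v\<close>.\<close>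
  define K where "K H = sat P (mult_sum (ring_module R) v (carrier R) H)" for H
  have sms: "N.sub (mult_sum (ring_module R) v (carrier R) H)" if "N.sub H" for H
    using N.sub_mult_sum[OF v(1) N.carrier_is_submodule that] by simp
  have K: "N.sub (K H)" "sat P (K H) \<subseteq> K H" "H \<subseteq> K H" "v \<in> K H" if "N.sub H" for H
  proof -
    have c: "N.sub (carrier R)" using N.carrier_is_submodule by simp
    note up = N.mult_sum_upper[OF v(1) c that]
    show "N.sub (K H)" "sat P (K H) \<subseteq> K H"
      unfolding K_def using N.sub_saturation[OF P sms[OF that]] N.saturation_idem[OF P] by auto
    show "H \<subseteq> K H" unfolding K_def using up(1) N.saturation_upper[OF P sms[OF that]] by blast
    have "v \<in> mult_sum (ring_module R) v (carrier R) H" using up(2)[of \<one>] v by simp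
    then show "v \<in> K H" unfolding K_def using N.saturation_upper[OF P sms[OF that]] by blast
  qed
  have K_mono: "K H \<subseteq> K H'" if "H \<subseteq> H'" for H H'
    unfolding K_def by (rule N.saturation_mono) (use that in \<open>auto simp: mult_sum_def\<close>)
  have K_least: "K H \<subseteq> H'" if "N.sub H'" "sat P H' \<subseteq> H'" "H \<subseteq> H'" "v \<in> H'" for H H'
  proof -
    interpret H': ideal H' R using that(1) sub_iff by simp
    have "mult_sum (ring_module R) v (carrier R) H \<subseteq> H'"
      using that H'.I_r_closed by (intro N.mult_sum_least) auto
    then show ?thesis unfolding K_def using N.saturation_mono that(2) by blast
  qed
  have "saturated_dcc P (K J)"
  proof (rule ccontr)
    assume "\<not> saturated_dcc P (K J)"
    then have "K J = J" using bspec[OF max, of "K J"] K[OF sJ] J(3) sub_iff by auto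
    then show False using K(4)[OF sJ] v by blast
  qed
  note dcc = this[unfolded saturated_dcc_def, rule_format]
  show False
  proof (cases "\<forall>n. v \<in> f n")
    case True
    then have "\<exists>n. \<forall>m\<ge>n. f m = f n"
      using f sf K_least by (intro dcc) auto
    with unstable show False by blast
  next
    case False
    then obtain n0 where n0: "v \<notin> f n0" by blast
    have "\<exists>n. \<forall>m\<ge>n. K (f m) = K (f n)"
      using K[OF sf] K_mono[OF f(4)] K_mono[OF f(3)] sub_iff by (intro dcc) auto
    then obtain n1 where n1: "\<And>m. m \<ge> n1 \<Longrightarrow> K (f m) = K (f n1)" by blast
    define n where "n = max n0 n1"
    \<comment> \<open>The ideals \<open>f n\<close> and \<open>f m\<close> agree after adjoining
      \<open>v\<close>, so an element of \<open>f n\<close> is, up to a factor outside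
      \<open>P\<close>, of the form \<open>v c + h'\<close> with \<open>h'\<close> in
      \<open>f m\<close>. Then \<open>v c\<close> is in \<open>f n\<close>; saturation and
      \<open>v\<close> outside \<open>f n\<close> force \<open>c\<close> into \<open>P\<close>, and
      \<open>P\<close> carries \<open>v\<close> into \<open>J\<close>, which lies in
      \<open>f m\<close>.\<close>
    have "f n \<subseteq> f m" if m: "m \<ge> n" for m
    proof
      fix h assume h: "h \<in> f n"
      interpret fn: ideal "f n" R by (rule f)
      interpret fm: ideal "f m" R by (rule f)
      have vn: "v \<notin> f n" using n0 anti[of n0 n] by (auto simp: n_def)
      have "K (f m) = K (f n)" using n1[of m] n1[of n] m by (simp add: n_def)
      then have "h \<in> K (f m)" using K(3)[OF sf] h by blast
      then obtain s c h' where s: "s \<in> carrier R" "s \<notin> P" "c \<in> carrier R" "h' \<in> f m"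
        "s \<otimes> h = v \<otimes> c \<oplus> h'" and hR: "h \<in> carrier R"
        by (auto simp: K_def saturation_def mult_sum_def)
      have "c \<in> P"
      proof (rule ccontr)
        assume "c \<notin> P"
        have "v \<otimes> c \<oplus> h' \<in> f n" using fn.I_l_closed[OF h s(1)] s(5) by simp
        moreover have "h' \<in> f n" using anti[OF m] s(4) by blast
        ultimately have "v \<otimes> c \<in> f n"
          using N.sub_add_cancel[OF sf, of "v \<otimes> c" h' n] v s(3) by simp
        then have "v \<in> sat P (f n)" using \<open>c \<notin> P\<close> s(3) v(1) by (auto simp: saturation_def m_comm)
        then show False using f(2) vn by blast
      qed
      then have "c \<otimes> v \<in> J" by (simp flip: colon_eq add: N.colon_iff)
      then have "v \<otimes> c \<in> f m" using subsetD[OF f(3)] v(1) s(3) by (simp add: m_comm)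
      then have "s \<otimes> h \<in> f m" using s(4,5) fm.a_closed by simp
      then have "h \<in> sat P (f m)" using s(1,2) hR by (auto simp: saturation_def)
      then show "h \<in> f m" using f(2) by blast
    qed
    then have "\<forall>m\<ge>n. f m = f n" using anti by blast
    with unstable show False by blast
  qed
qed

text \<open>In the domain \<open>R / P0\<close> this says that a minimal prime \<open>P\<close> over
  \<open>x\<close> has height at most one. Instead of symbolic powers of \<open>Q\<close>, those of
  one element \<open>a\<close> of \<open>Q\<close> are used: \<open>J n\<close> is the preimage of
  \<open>a^n R_Q + P0 R_Q\<close>. Above \<open>x\<close> the \<open>J n\<close> stabilize since
  \<open>R_P / (P0, x) R_P\<close> is Artinian; Nakayama removes \<open>x\<close>, so
  \<open>a^n\<close> is in \<open>a^(n+1) R_Q + P0 R_Q\<close>. Cancelling \<open>a^n\<close> modulo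
  \<open>P0\<close> puts an element outside \<open>Q\<close> into \<open>P0\<close>.\<close>

theorem krull_principal_ideal:
  assumes P0: "primeideal P0 R" and Q: "primeideal Q R" and P: "primeideal P R"
    and lt: "P0 \<subset> Q" "Q \<subset> P" and x: "x \<in> P"
    and min: "\<And>Q'. primeideal Q' R \<Longrightarrow> P0 \<subseteq> Q' \<Longrightarrow> x \<in> Q' \<Longrightarrow> Q' \<subseteq> P \<Longrightarrow> Q' = P"
  shows False
proof -
  interpret N: noetherian_module R "ring_module R" by (rule noetherian_module)
  interpret P0: primeideal P0 R by fact
  interpret Q: primeideal Q R by fact
  interpret P: primeideal P R by fact
  note sub_iff = submodule_ring_module_iff
  have xR: "x \<in> carrier R" using x P.a_Hcarr by blast
  have c: "N.sub (carrier R)" using N.carrier_is_submodule by simp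
  have sP0: "N.sub P0" using P0.is_ideal sub_iff by simp
  have xQ: "x \<notin> Q" using min[OF Q] lt by blast
  obtain a where a: "a \<in> Q" "a \<notin> P0" using lt by blast
  have aR: "a \<in> carrier R" using a Q.a_Hcarr by blast
  let ?ms = "mult_sum (ring_module R)"
  define J where "J n = sat Q (?ms (a [^] (n::nat)) (carrier R) P0)" for n
  have sms: "N.sub (?ms y (carrier R) H)" if "y \<in> carrier R" "N.sub H" for y H
    using N.sub_mult_sum[OF that(1) c that(2)] .
  have sJ: "N.sub (J n)" and satJ: "sat Q (J n) \<subseteq> J n" and P0J: "P0 \<subseteq> J n"
    and aJ: "a [^] n \<in> J n" for n
  proof -
    have an: "a [^] n \<in> carrier R" using aR by simp
    note up = N.mult_sum_upper[OF an c sP0] and satup = N.saturation_upper[OF Q sms[OF an sP0]]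
    show "N.sub (J n)" "sat Q (J n) \<subseteq> J n"
      unfolding J_def using N.sub_saturation[OF Q sms[OF an sP0]] N.saturation_idem[OF Q] by auto
    show "P0 \<subseteq> J n" unfolding J_def using up(1) satup by blast
    have "a [^] n \<in> ?ms (a [^] n) (carrier R) P0" using up(2)[of \<one>] an by simp
    then show "a [^] n \<in> J n" unfolding J_def using satup by blast
  qed
  have J_anti: "J (Suc n) \<subseteq> J n" for n
  proof -
    interpret Jn: ideal "J n" R using sJ sub_iff by simp
    have "?ms (a [^] Suc n) (carrier R) P0 \<subseteq> J n"
      using P0J aJ aR Jn.I_r_closed by (intro N.mult_sum_least sJ) auto
    then show ?thesis unfolding J_def[of "Suc n"] using N.saturation_mono satJ by blast
  qed
  define I where "I H = sat P (?ms x (carrier R) H)" for H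
  have I: "N.sub (I H)" "sat P (I H) \<subseteq> I H" "H \<subseteq> I H" "x \<in> I H" if "N.sub H" for H
  proof -
    note up = N.mult_sum_upper[OF xR c that] and satup = N.saturation_upper[OF P sms[OF xR that]]
    show "N.sub (I H)" "sat P (I H) \<subseteq> I H"
      unfolding I_def using N.sub_saturation[OF P sms[OF xR that]] N.saturation_idem[OF P] by auto
    show "H \<subseteq> I H" unfolding I_def using up(1) satup by blast
    have "x \<in> ?ms x (carrier R) H" using up(2)[of \<one>] xR by simp
    then show "x \<in> I H" unfolding I_def using satup by blast
  qed
  have I_mono: "I H \<subseteq> I H'" if "H \<subseteq> H'" for H H'
    unfolding I_def by (rule N.saturation_mono) (use that in \<open>auto simp: mult_sum_def\<close>)
  have "saturated_dcc P (I P0)"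
  proof (rule saturated_dcc_minimal_prime[OF P])
    show "Q' = P" if "primeideal Q' R" "I P0 \<subseteq> Q'" "Q' \<subseteq> P" for Q'
      using min[OF that(1)] I(3,4)[OF sP0] that by blast
  qed (use I[OF sP0] sub_iff in auto)
  note dcc = this[unfolded saturated_dcc_def, rule_format]
  have "\<exists>n. \<forall>m\<ge>n. I (J m) = I (J n)"
    using I[OF sJ] I_mono[OF P0J] I_mono[OF J_anti] sub_iff by (intro dcc) auto
  then obtain n where n: "I (J (Suc n)) = I (J n)" by (meson le_SucI order_refl)
  have "J n \<subseteq> sat P (?ms x (J n) (J (Suc n)))"
  proof
    fix r assume r: "r \<in> J n"
    then have "r \<in> I (J (Suc n))" using I(3)[OF sJ] n by blast
    then obtain s t j where s: "s \<in> carrier R" "s \<notin> P" "t \<in> carrier R" "j \<in> J (Suc n)"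
      "s \<otimes> r = x \<otimes> t \<oplus> j" and rR: "r \<in> carrier R"
      by (auto simp: I_def saturation_def mult_sum_def)
    interpret Jn: ideal "J n" R using sJ sub_iff by simp
    \<comment> \<open>As \<open>x\<close> is outside \<open>Q\<close> and \<open>J n\<close> is
      \<open>Q\<close>-saturated, the cofactor \<open>t\<close> lies in \<open>J n\<close>; this is
      what turns stabilization into a case for Nakayama.\<close>
    have "x \<otimes> t \<in> J n"
      using N.sub_add_cancel[OF sJ, of "x \<otimes> t" j n] Jn.I_l_closed[OF r s(1)] s xR J_anti[of n] by auto
    then have "t \<in> sat Q (J n)" using xQ xR s(3) by (auto simp: saturation_def)
    then have "t \<in> J n" using satJ by blast
    then have "x \<otimes> t \<oplus> j \<in> ?ms x (J n) (J (Suc n))"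
      using N.mult_sumI[of t "J n" j "J (Suc n)" x] s(4) by simp
    then have "s \<otimes> r \<in> ?ms x (J n) (J (Suc n))" by (simp only: s(5))
    then show "r \<in> sat P (?ms x (J n) (J (Suc n)))"
      using s(1,2) rR by (auto simp: saturation_def)
  qed
  then have "J n \<subseteq> sat P (J (Suc n))" by (rule N.nakayama_saturation[OF P x sJ sJ])
  also have "\<dots> \<subseteq> sat Q (J (Suc n))" using lt(2) by (auto simp: saturation_def)
  also have "\<dots> \<subseteq> J (Suc n)" by (rule satJ)
  finally have "a [^] n \<in> J (Suc n)" using aJ by blast
  then obtain s c p where s: "s \<in> carrier R" "s \<notin> Q" "c \<in> carrier R" "p \<in> P0"
    "s \<otimes> a [^] n = a [^] Suc n \<otimes> c \<oplus> p"
    by (auto simp: J_def saturation_def mult_sum_def)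
  have an: "a [^] n \<in> carrier R" using aR by simp
  have pR: "p \<in> carrier R" using s P0.a_Hcarr by blast
  have "(s \<ominus> a \<otimes> c) \<otimes> a [^] n = s \<otimes> a [^] n \<ominus> a [^] Suc n \<otimes> c"
  proof -
    have "a \<otimes> c \<otimes> a [^] n = a [^] Suc n \<otimes> c" using s(3) aR an by (simp add: m_ac)
    then show ?thesis using s(1,3) aR an by (simp add: minus_eq l_distr l_minus del: nat_pow_Suc)
  qed
  also have "\<dots> = p"
    using s(5,3) pR aR an by (simp add: minus_eq a_comm[of _ p] a_assoc r_neg)
  finally have "s \<ominus> a \<otimes> c \<in> P0 \<or> a [^] n \<in> P0"
    using P0.I_prime[of "s \<ominus> a \<otimes> c" "a [^] n"] s aR an by simp
  then have "s \<ominus> a \<otimes> c \<in> P0" using P0.power_mem[OF aR] a(2) by blast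
  then have "s \<ominus> a \<otimes> c \<in> Q" using lt by blast
  moreover have "a \<otimes> c \<in> Q" using Q.I_r_closed a s by blast
  ultimately have "(s \<ominus> a \<otimes> c) \<oplus> a \<otimes> c \<in> Q" by (rule Q.a_closed)
  then show False using s aR by (simp add: minus_eq a_assoc l_neg)
qed

text \<open>If \<open>x\<close> is not in \<open>P1\<close>, the principal ideal theorem forbids
  \<open>P2\<close> from being minimal over \<open>P0\<close> and \<open>x\<close>; a smaller such
  prime works, and it differs from \<open>P0\<close> because \<open>x\<close> is not in
  \<open>P0\<close>.\<close>

lemma intermediate_prime_containing:
  assumes "primeideal P0 R" "primeideal P1 R" "primeideal P2 R" "P0 \<subset> P1" "P1 \<subset> P2" "x \<in> P2"
  shows "\<exists>P. primeideal P R \<and> P0 \<subset> P \<and> P \<subset> P2 \<and> x \<in> P"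
proof (cases "x \<in> P1")
  case True with assms show ?thesis by blast
next
  case False
  obtain Q where "primeideal Q R" "P0 \<subseteq> Q" "x \<in> Q" "Q \<subseteq> P2" "Q \<noteq> P2"
    using krull_principal_ideal[OF assms] by blast
  moreover have "x \<notin> P0" using False assms(4) by blast
  ultimately show ?thesis by blast
qed

text \<open>Working down from the top, each prime strictly between the ends is exchanged for one
  containing \<open>x\<close>. The lowest prime has none below it to allow an exchange, so it is
  dropped, at the cost of one inclusion.\<close>

lemma prime_chain_through:
  "\<lbrakk>prime_chain R (Suc n) A B; x \<in> B\<rbrakk> \<Longrightarrow> \<exists>A'. A \<subseteq> A' \<and> x \<in> A' \<and> prime_chain R n A' B"
proof (induction n arbitrary: B)
  case 0
  then have "primeideal B R" "A \<subseteq> B" using prime_chain_primes prime_chain_subset by blast+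
  with 0 show ?case using prime_chain.single by blast
next
  case (Suc n)
  obtain C where C: "prime_chain R (Suc n) A C" "C \<subset> B" "primeideal B R"
    using Suc.prems(1) by (cases rule: prime_chain.cases) auto
  obtain D where D: "prime_chain R n A D" "D \<subset> C" "primeideal C R"
    using C(1) by (cases rule: prime_chain.cases) auto
  obtain C' where C': "primeideal C' R" "D \<subset> C'" "C' \<subset> B" "x \<in> C'"
    using intermediate_prime_containing[OF _ D(3) C(3) D(2) C(2) Suc.prems(2)]
      prime_chain_primes[OF D(1)] by blast
  have "prime_chain R (Suc n) A C'" using D(1) C'(2,1) by (rule prime_chain.step)
  then obtain A' where "A \<subseteq> A'" "x \<in> A'" "prime_chain R n A' C'" using Suc.IH C'(4) by blast
  with C'(3) C(3) show ?case using prime_chain.step by blast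
qed

lemma prime_chain_through_finite:
  assumes "finite F"
  shows "\<lbrakk>prime_chain R (card F + n) A B; F \<subseteq> B\<rbrakk> \<Longrightarrow> \<exists>A'. F \<subseteq> A' \<and> prime_chain R n A' B"
  using assms
proof (induction F arbitrary: n rule: finite_induct)
  case empty then show ?case by auto
next
  case (insert x F)
  obtain A' where A': "F \<subseteq> A'" "prime_chain R (Suc n) A' B"
    using insert.IH[of "Suc n"] insert.prems insert.hyps by auto
  then show ?case using prime_chain_through[OF A'(2), of x] insert.prems(2) by blast
qed

end

sublocale noetherian_local_ring \<subseteq> noetherian_cring ..

context noetherian_local_ring
begin

text \<open>A chain of length greater than \<open>card S\<close>, prolonged to end at
  \<open>M\<close>, can be made to start above all generators \<open>S\<close> of \<open>M\<close>
  while keeping at least one strict inclusion. Its first prime then contains \<open>M\<close> and is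
  strictly contained in \<open>M\<close>.\<close>

theorem prime_chain_bounded: "\<exists>d. \<forall>n A B. prime_chain R n A B \<longrightarrow> n \<le> d"
proof -
  have Mi: "ideal M R" using maximal by (rule maximalideal.axioms)
  obtain S where S: "S \<subseteq> carrier R" "finite S" "M = Idl S" using finetely_gen[OF Mi] by blast
  have SM: "S \<subseteq> M" using genideal_self[OF S(1)] S(3) by simp
  have "n \<le> card S" if chain: "prime_chain R n A B" for n A B
  proof (rule ccontr)
    assume "\<not> n \<le> card S"
    have B: "primeideal B R" using prime_chain_primes[OF chain] by blast
    have BM: "B \<subseteq> M"
      using proper_ideal_subset_maximal primeideal.axioms(1)[OF B] primeideal.I_notcarr[OF B] by blast
    obtain m where m: "m \<ge> n" "prime_chain R m A M"
    proof (cases "B = M")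
      case False
      with that[of "Suc n"] show ?thesis
        using prime_chain.step[OF chain _ primeideal_maximal] BM by auto
    qed (use that chain in auto)
    have "m = card S + Suc (m - Suc (card S))" using m(1) \<open>\<not> n \<le> card S\<close> by simp
    then obtain A' where A': "S \<subseteq> A'" "prime_chain R (Suc (m - Suc (card S))) A' M"
      using prime_chain_through_finite[OF S(2) _ SM] m(2) by metis
    have "M \<subseteq> A'"
      using genideal_minimal A'(1) S(3) prime_chain_primes[OF A'(2)] primeideal.axioms(1) by blast
    then show False using prime_chain_subset[OF A'(2)] by auto
  qed
  then show ?thesis by blast
qed

text \<open>Properness of \<open>J\<close> rules out dimension \<open>-\<infinity>\<close>, the
  bound on chains rules out \<open>\<infinity>\<close>.\<close>

lemma krull_dim_quot_nat:
  assumes J: "ideal J R" "J \<noteq> carrier R"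
  obtains d where "krull_dim (R Quot J) = ereal (real d)"
proof -
  let ?C = "\<lambda>n. \<exists>A B. J \<subseteq> A \<and> prime_chain R n A B"
  obtain b where b: "\<And>n A B. prime_chain R n A B \<Longrightarrow> n \<le> b" using prime_chain_bounded by blast
  have ex: "?C 0"
    using proper_ideal_subset_maximal[OF J] prime_chain.single[OF primeideal_maximal] by blast
  define d where "d = (GREATEST n. ?C n)"
  have d: "?C d" unfolding d_def using ex b by (intro GreatestI_nat[where P = ?C and b = b]) blast+
  have "n \<le> d" if "?C n" for n
    unfolding d_def using that b by (intro Greatest_le_nat[where P = ?C and b = b]) blast+
  then have "krull_dim (R Quot J) \<le> ereal (real d)" by (auto simp: krull_dim_quot_le_iff[OF J(1)])
  moreover have "ereal (real d) \<le> krull_dim (R Quot J)" using d krull_dim_quot_ge[OF J(1)] by blast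
  ultimately show ?thesis using that by (meson antisym)
qed

end

section \<open>Regular sequences on quotient modules\<close>

text \<open>A regular sequence on \<open>A / B\<close> in the form of the recursion of
  \<open>depth_ge\<close>: quotients are taken by enlarging \<open>B\<close>, and the base case is
  the condition that the final quotient is nonzero.\<close>

primrec regular_seq ::
    "('a, 'r) ring_scheme \<Rightarrow> ('a, 'b, 'm) module_scheme \<Rightarrow> 'b set \<Rightarrow> 'a list \<Rightarrow> 'b set \<Rightarrow> bool"
  where
    "regular_seq R N A [] B \<longleftrightarrow> A \<noteq> B"
  | "regular_seq R N A (x # xs) B \<longleftrightarrow>
      x \<in> carrier R \<and> regular_on N x A B \<and> regular_seq R N A xs (mult_sum N x A B)"

lemma regular_seq_iff_foldl:
  "regular_seq R N A xs B \<longleftrightarrow> set xs \<subseteq> carrier R \<and>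
    (\<forall>i<length xs. regular_on N (xs ! i) A (foldl (\<lambda>B x. mult_sum N x A B) B (take i xs))) \<and>
    A \<noteq> foldl (\<lambda>B x. mult_sum N x A B) B xs"
proof (induction xs arbitrary: B)
  case (Cons x xs)
  show ?case by (auto simp: Cons.IH All_less_Suc2)
qed simp

lemma mult_sum_restrict: "mult_sum (N\<lparr>carrier := A\<rparr>) = mult_sum N"
  by (simp add: mult_sum_def fun_eq_iff)

lemma regular_seq_restrict: "regular_seq R (N\<lparr>carrier := A\<rparr>) C xs B = regular_seq R N C xs B"
  by (induction xs arbitrary: B) (auto simp: mult_sum_restrict regular_on_def)

context module_over
begin

lemma subI:
  assumes "H \<subseteq> carrier N" "\<zero>\<^bsub>N\<^esub> \<in> H" "\<And>u v. u \<in> H \<Longrightarrow> v \<in> H \<Longrightarrow> u \<oplus>\<^bsub>N\<^esub> v \<in> H"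
    "\<And>a u. a \<in> carrier R \<Longrightarrow> u \<in> H \<Longrightarrow> a \<odot>\<^bsub>N\<^esub> u \<in> H"
  shows "sub H"
proof (rule submoduleI)
  fix u assume u: "u \<in> H"
  then have "\<ominus>\<^bsub>N\<^esub> u = (\<ominus> \<one>) \<odot>\<^bsub>N\<^esub> u" using assms(1) by (simp add: smult_l_minus subset_iff)
  then show "\<ominus>\<^bsub>N\<^esub> u \<in> H" using assms(4)[OF _ u, of "\<ominus> \<one>"] by simp
qed (use assms in auto)

lemma sub_singleton_zero: "sub {\<zero>\<^bsub>N\<^esub>}"
  by (rule subI) auto

lemma ideal_smult_insert:
  assumes "x \<in> carrier R" "S \<subseteq> carrier R"
  shows "ideal_smult R N (insert x S) = mult_sum N x (carrier N) (ideal_smult R N S)"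
proof -
  let ?G = "\<lambda>S. {a \<odot>\<^bsub>N\<^esub> u | a u. a \<in> S \<and> u \<in> carrier N}"
  have G: "?G S \<subseteq> carrier N" "?G (insert x S) \<subseteq> carrier N" using assms by auto
  have sS: "sub (ideal_smult R N S)" and sxS: "sub (ideal_smult R N (insert x S))"
    unfolding ideal_smult_def using sub_gen_submodule[OF G(1)] sub_gen_submodule[OF G(2)] .
  note up = mult_sum_upper[OF assms(1) carrier_is_submodule sS]
  have gS: "?G S \<subseteq> ideal_smult R N S" "?G (insert x S) \<subseteq> ideal_smult R N (insert x S)"
    unfolding ideal_smult_def by (rule gen_submodule_upper)+
  show ?thesis
  proof
    show "ideal_smult R N (insert x S) \<subseteq> mult_sum N x (carrier N) (ideal_smult R N S)"
      unfolding ideal_smult_def[of R N "insert x S"]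
      using up(2) subset_trans[OF gS(1) up(1)]
      by (intro gen_submodule_least sub_mult_sum assms(1) carrier_is_submodule sS) blast
    have "?G S \<subseteq> ?G (insert x S)" by blast
    then have "?G S \<subseteq> ideal_smult R N (insert x S)" using gS(2) by (rule subset_trans)
    then have "ideal_smult R N S \<subseteq> ideal_smult R N (insert x S)"
      unfolding ideal_smult_def[of R N S] by (intro gen_submodule_least sxS)
    then show "mult_sum N x (carrier N) (ideal_smult R N S) \<subseteq> ideal_smult R N (insert x S)"
      using gS(2) by (intro mult_sum_least sxS) auto
  qed
qed

lemma ideal_smult_set_list:
  assumes "set xs \<subseteq> carrier R"
  shows "ideal_smult R N (set xs) = foldl (\<lambda>B x. mult_sum N x (carrier N) B) {\<zero>\<^bsub>N\<^esub>} xs"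
  using assms
proof (induction xs rule: rev_induct)
  case Nil
  have "gen_submodule R N {} \<subseteq> {\<zero>\<^bsub>N\<^esub>}"
    using sub_singleton_zero by (rule gen_submodule_least) simp
  moreover have "sub (gen_submodule R N {})" by (rule sub_gen_submodule) simp
  ultimately show ?case using sub_zero by (auto simp: ideal_smult_def)
next
  case (snoc x xs)
  then show ?case using ideal_smult_insert[of x "set xs"] by simp
qed

lemma sub_ideal_smult: "S \<subseteq> carrier R \<Longrightarrow> sub (ideal_smult R N S)"
  unfolding ideal_smult_def by (rule sub_gen_submodule) auto

lemma mem_coset_iff: "v \<in> K +>\<^bsub>N\<^esub> u \<longleftrightarrow> (\<exists>k\<in>K. v = k \<oplus>\<^bsub>N\<^esub> u)"
  by (auto simp: a_r_coset_def')

lemma coset_eq_iff: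
  assumes K: "sub K" and "u \<in> carrier N" "v \<in> carrier N"
  shows "K +>\<^bsub>N\<^esub> u = K +>\<^bsub>N\<^esub> v \<longleftrightarrow> u \<ominus>\<^bsub>N\<^esub> v \<in> K"
proof
  have "u \<in> K +>\<^bsub>N\<^esub> u"
    unfolding mem_coset_iff using sub_zero[OF K] assms(2) by (intro bexI[of _ "\<zero>\<^bsub>N\<^esub>"]) auto
  moreover assume "K +>\<^bsub>N\<^esub> u = K +>\<^bsub>N\<^esub> v"
  ultimately obtain k where k: "k \<in> K" "u = k \<oplus>\<^bsub>N\<^esub> v" by (auto simp: mem_coset_iff)
  then have "u \<ominus>\<^bsub>N\<^esub> v = k"
    using assms sub_carrier[OF K k(1)] by (simp add: M.minus_eq M.a_assoc M.r_neg)
  with k(1) show "u \<ominus>\<^bsub>N\<^esub> v \<in> K" by simp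
next
  have sg: "subgroup K (add_monoid N)" using K by (rule submodule.axioms)
  assume "u \<ominus>\<^bsub>N\<^esub> v \<in> K"
  moreover have "u = (u \<ominus>\<^bsub>N\<^esub> v) \<oplus>\<^bsub>N\<^esub> v"
    using assms by (simp add: M.minus_eq M.a_assoc M.l_neg)
  ultimately have "u \<in> K +>\<^bsub>N\<^esub> v" unfolding mem_coset_iff by blast
  then show "K +>\<^bsub>N\<^esub> u = K +>\<^bsub>N\<^esub> v"
    using M.a_repr_independence[OF _ assms(3) sg] by blast
qed

lemma coset_zero: "sub K \<Longrightarrow> K +>\<^bsub>N\<^esub> \<zero>\<^bsub>N\<^esub> = K"
  using sub_carrier by (auto simp: mem_coset_iff intro: bexI[rotated])

lemma coset_eq_self_iff:
  assumes "sub K" "u \<in> carrier N" shows "K +>\<^bsub>N\<^esub> u = K \<longleftrightarrow> u \<in> K"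
proof -
  have "u \<ominus>\<^bsub>N\<^esub> \<zero>\<^bsub>N\<^esub> = u" using assms(2) M.add.inv_one by (simp add: M.minus_eq a_inv_def)
  then show ?thesis using coset_eq_iff[OF assms M.zero_closed] coset_zero[OF assms(1)] by simp
qed

lemma quot_module_carrier: "carrier (quot_module N K) = (\<lambda>u. K +>\<^bsub>N\<^esub> u) ` carrier N"
  by (auto simp: quot_module_def A_RCOSETS_def')

lemma quot_module_zero: "\<zero>\<^bsub>quot_module N K\<^esub> = K"
  by (simp add: quot_module_def)

lemma quot_module_add:
  assumes K: "sub K" and "u \<in> carrier N" "v \<in> carrier N"
  shows "(K +>\<^bsub>N\<^esub> u) \<oplus>\<^bsub>quot_module N K\<^esub> (K +>\<^bsub>N\<^esub> v) = K +>\<^bsub>N\<^esub> (u \<oplus>\<^bsub>N\<^esub> v)"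
proof -
  have "subgroup K (add_monoid N)" using K by (rule submodule.axioms)
  then have "abelian_subgroup K N"
    by (intro abelian_subgroupI3 M.abelian_group_axioms additive_subgroupI)
  then show ?thesis using abelian_subgroup.a_rcos_sum assms by (simp add: quot_module_def)
qed

lemma quot_module_smult:
  assumes K: "sub K" and a: "a \<in> carrier R" and u: "u \<in> carrier N"
  shows "a \<odot>\<^bsub>quot_module N K\<^esub> (K +>\<^bsub>N\<^esub> u) = K +>\<^bsub>N\<^esub> (a \<odot>\<^bsub>N\<^esub> u)"
proof -
  have "K +>\<^bsub>N\<^esub> (a \<odot>\<^bsub>N\<^esub> v) = K +>\<^bsub>N\<^esub> (a \<odot>\<^bsub>N\<^esub> u)" if "v \<in> K +>\<^bsub>N\<^esub> u" for v
  proof -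
    obtain k where k: "k \<in> K" "v = k \<oplus>\<^bsub>N\<^esub> u" using \<open>v \<in> _\<close> by (auto simp: mem_coset_iff)
    have kN: "k \<in> carrier N" using sub_carrier[OF K k(1)] .
    have "a \<odot>\<^bsub>N\<^esub> v \<ominus>\<^bsub>N\<^esub> a \<odot>\<^bsub>N\<^esub> u = a \<odot>\<^bsub>N\<^esub> k"
      using a u k(2) kN by (simp add: smult_r_distr M.minus_eq M.a_assoc M.r_neg)
    then show ?thesis
      using coset_eq_iff[OF K, of "a \<odot>\<^bsub>N\<^esub> v" "a \<odot>\<^bsub>N\<^esub> u"] sub_smult[OF K a k(1)] a u k(2) kN by simp
  qed
  moreover have "u \<in> K +>\<^bsub>N\<^esub> u"
    unfolding mem_coset_iff using sub_zero[OF K] u by (intro bexI[of _ "\<zero>\<^bsub>N\<^esub>"]) auto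
  ultimately have "(\<Union>v\<in>K +>\<^bsub>N\<^esub> u. K +>\<^bsub>N\<^esub> (a \<odot>\<^bsub>N\<^esub> v)) = K +>\<^bsub>N\<^esub> (a \<odot>\<^bsub>N\<^esub> u)" by blast
  then show ?thesis by (simp add: quot_module_def)
qed

lemma module_quot_module:
  assumes K: "sub K" shows "module R (quot_module N K)"
proof (rule moduleI)
  note ops = quot_module_carrier quot_module_zero quot_module_add[OF K] quot_module_smult[OF K]
  show "abelian_group (quot_module N K)"
  proof (rule abelian_groupI)
    fix U assume "U \<in> carrier (quot_module N K)"
    then obtain u where u: "u \<in> carrier N" "U = K +>\<^bsub>N\<^esub> u" by (auto simp: ops)
    have "(K +>\<^bsub>N\<^esub> \<zero>\<^bsub>N\<^esub>) \<oplus>\<^bsub>quot_module N K\<^esub> U = U" using u by (simp add: ops)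
    then show "\<zero>\<^bsub>quot_module N K\<^esub> \<oplus>\<^bsub>quot_module N K\<^esub> U = U"
      by (simp add: coset_zero[OF K] quot_module_zero)
    have "(K +>\<^bsub>N\<^esub> \<ominus>\<^bsub>N\<^esub> u) \<oplus>\<^bsub>quot_module N K\<^esub> U = K"
      using u by (simp add: ops M.l_neg coset_zero[OF K])
    then show "\<exists>V\<in>carrier (quot_module N K). V \<oplus>\<^bsub>quot_module N K\<^esub> U = \<zero>\<^bsub>quot_module N K\<^esub>"
      using u(1) by (intro bexI[of _ "K +>\<^bsub>N\<^esub> \<ominus>\<^bsub>N\<^esub> u"]) (auto simp: quot_module_carrier quot_module_zero)
  next
    show "\<zero>\<^bsub>quot_module N K\<^esub> \<in> carrier (quot_module N K)"
      using coset_zero[OF K] by (auto simp: ops intro: image_eqI[of _ _ "\<zero>\<^bsub>N\<^esub>"])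
  qed (auto simp: ops M.a_ac)
qed (auto simp: quot_module_carrier quot_module_add[OF K] quot_module_smult[OF K] smult_l_distr
    smult_r_distr smult_assoc1 R.is_cring)

lemma nonzerodivisor_on_quot_module:
  assumes "sub K" "a \<in> carrier R"
  shows "nonzerodivisor_on (quot_module N K) a \<longleftrightarrow> regular_on N a (carrier N) K"
  using assms by (simp add: nonzerodivisor_on_def regular_on_def quot_module_carrier
      quot_module_zero quot_module_smult coset_eq_self_iff)

lemma zero_module_quot_module:
  assumes K: "sub K" shows "zero_module (quot_module N K) \<longleftrightarrow> carrier N = K"
proof -
  have "zero_module (quot_module N K) \<longleftrightarrow> (\<forall>u\<in>carrier N. K +>\<^bsub>N\<^esub> u = K)"
    unfolding zero_module_def quot_module_carrier quot_module_zero by (auto intro: exI[of _ "\<zero>\<^bsub>N\<^esub>"])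
  also have "\<dots> \<longleftrightarrow> carrier N \<subseteq> K" using coset_eq_self_iff[OF K] by auto
  finally show ?thesis using submoduleE(1)[OF K] by blast
qed

lemma regular_sequence_iff: "regular_sequence R N xs \<longleftrightarrow> regular_seq R N (carrier N) xs {\<zero>\<^bsub>N\<^esub>}"
proof (cases "set xs \<subseteq> carrier R")
  case True
  then have take: "set (take i xs) \<subseteq> carrier R" for i by (rule subset_trans[OF set_take_subset])
  have "nonzerodivisor_on (quot_module N (ideal_smult R N (set (take i xs)))) (xs ! i) \<longleftrightarrow>
      regular_on N (xs ! i) (carrier N) (foldl (\<lambda>B x. mult_sum N x (carrier N) B) {\<zero>\<^bsub>N\<^esub>} (take i xs))"
    if "i < length xs" for i
    using nonzerodivisor_on_quot_module[OF sub_ideal_smult[OF take], of "xs ! i"] True that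
    by (auto simp: ideal_smult_set_list[OF take] subset_iff)
  moreover have "zero_module (quot_module N (ideal_smult R N (set xs))) \<longleftrightarrow>
      carrier N = foldl (\<lambda>B x. mult_sum N x (carrier N) B) {\<zero>\<^bsub>N\<^esub>} xs"
    using zero_module_quot_module[OF sub_ideal_smult[OF True]] ideal_smult_set_list[OF True] by simp
  ultimately show ?thesis unfolding regular_sequence_def regular_seq_iff_foldl by simp
qed (simp add: regular_sequence_def regular_seq_iff_foldl)

text \<open>By the correspondence of submodules of \<open>N / K\<close> with submodules of
  \<open>N\<close> above \<open>K\<close>, the recursion on \<open>N / K\<close> becomes the
  recursion on \<open>N\<close>. The starting \<open>H\<close> is arbitrary because it grows along
  the sequence.\<close>

lemma regular_seq_quot_module:
  assumes K: "sub K"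
  shows "submodule H R (quot_module N K) \<Longrightarrow>
    regular_seq R (quot_module N K) (carrier (quot_module N K)) xs H \<longleftrightarrow>
    regular_seq R N (carrier N) xs {u \<in> carrier N. K +>\<^bsub>N\<^esub> u \<in> H}"
proof (induction xs arbitrary: H)
  case Nil
  interpret Q: module_over R "quot_module N K"
    using module_quot_module[OF K] by (simp add: module_over_def)
  show ?case using Q.submoduleE(1)[OF Nil] by (auto simp: quot_module_carrier)
next
  case (Cons x xs)
  let ?Q = "quot_module N K"
  interpret Q: module_over R ?Q
    using module_quot_module[OF K] by (simp add: module_over_def)
  have H: "Q.sub H" by fact
  let ?pre = "\<lambda>H. {u \<in> carrier N. K +>\<^bsub>N\<^esub> u \<in> H}"
  show ?case
  proof (cases "x \<in> carrier R")
    case x: True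
    have "regular_on ?Q x (carrier ?Q) H \<longleftrightarrow> regular_on N x (carrier N) (?pre H)"
      using x by (simp add: regular_on_def quot_module_carrier quot_module_smult[OF K])
    moreover have "?pre (mult_sum ?Q x (carrier ?Q) H) = mult_sum N x (carrier N) (?pre H)"
    proof (intro Set.set_eqI iffI)
      fix u assume "u \<in> ?pre (mult_sum ?Q x (carrier ?Q) H)"
      then have u: "u \<in> carrier N" and uQ: "K +>\<^bsub>N\<^esub> u \<in> mult_sum ?Q x (carrier ?Q) H" by auto
      obtain U V where UV: "U \<in> carrier ?Q" "V \<in> H" "K +>\<^bsub>N\<^esub> u = x \<odot>\<^bsub>?Q\<^esub> U \<oplus>\<^bsub>?Q\<^esub> V"
        using uQ by (rule Q.mult_sumE)
      have VQ: "V \<in> carrier ?Q" using Q.sub_carrier[OF H UV(2)] .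
      obtain a b where ab: "a \<in> carrier N" "U = K +>\<^bsub>N\<^esub> a" "b \<in> carrier N" "V = K +>\<^bsub>N\<^esub> b"
        using UV(1) VQ by (auto simp: quot_module_carrier)
      let ?w = "x \<odot>\<^bsub>N\<^esub> a \<oplus>\<^bsub>N\<^esub> b"
      have "K +>\<^bsub>N\<^esub> u = K +>\<^bsub>N\<^esub> ?w"
        using UV(3) ab x by (simp add: quot_module_smult[OF K] quot_module_add[OF K])
      then have k: "u \<ominus>\<^bsub>N\<^esub> ?w \<in> K" using coset_eq_iff[OF K u] ab x by simp
      have kN: "u \<ominus>\<^bsub>N\<^esub> ?w \<in> carrier N" using u ab x by simp
      \<comment> \<open>The lifts \<open>a\<close> and \<open>b\<close> represent \<open>u\<close>
        only up to an error in \<open>K\<close>; it is absorbed into \<open>b\<close>, whose class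
        is unchanged.\<close>
      have "K +>\<^bsub>N\<^esub> (b \<oplus>\<^bsub>N\<^esub> (u \<ominus>\<^bsub>N\<^esub> ?w)) = V \<oplus>\<^bsub>?Q\<^esub> K"
        using quot_module_add[OF K ab(3) kN] ab(4) coset_eq_self_iff[OF K kN] k by simp
      also have "\<dots> = V" using VQ Q.M.r_zero[of V] by (simp add: quot_module_zero)
      finally have "b \<oplus>\<^bsub>N\<^esub> (u \<ominus>\<^bsub>N\<^esub> ?w) \<in> ?pre H" using UV(2) ab(3) kN by simp
      moreover have "u = x \<odot>\<^bsub>N\<^esub> a \<oplus>\<^bsub>N\<^esub> (b \<oplus>\<^bsub>N\<^esub> (u \<ominus>\<^bsub>N\<^esub> ?w))"
      proof -
        have "x \<odot>\<^bsub>N\<^esub> a \<oplus>\<^bsub>N\<^esub> (b \<oplus>\<^bsub>N\<^esub> (u \<ominus>\<^bsub>N\<^esub> ?w)) = ?w \<oplus>\<^bsub>N\<^esub> (u \<ominus>\<^bsub>N\<^esub> ?w)"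
          using ab x kN by (simp add: M.a_assoc)
        also have "\<dots> = u" using ab x u by (simp add: M.minus_eq M.a_comm[of u] M.r_neg2)
        finally show ?thesis by simp
      qed
      ultimately show "u \<in> mult_sum N x (carrier N) (?pre H)" using mult_sumI[OF ab(1)] by metis
    next
      fix u assume "u \<in> mult_sum N x (carrier N) (?pre H)"
      then obtain a b where ab: "a \<in> carrier N" "b \<in> ?pre H" "u = x \<odot>\<^bsub>N\<^esub> a \<oplus>\<^bsub>N\<^esub> b"
        by (rule mult_sumE)
      then have b: "b \<in> carrier N" "K +>\<^bsub>N\<^esub> b \<in> H" by auto
      have "K +>\<^bsub>N\<^esub> u = x \<odot>\<^bsub>?Q\<^esub> (K +>\<^bsub>N\<^esub> a) \<oplus>\<^bsub>?Q\<^esub> (K +>\<^bsub>N\<^esub> b)"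
        using ab b(1) x by (simp add: quot_module_smult[OF K] quot_module_add[OF K])
      also have "\<dots> \<in> mult_sum ?Q x (carrier ?Q) H"
        using b(2) ab(1) by (intro Q.mult_sumI) (auto simp: quot_module_carrier)
      finally show "u \<in> ?pre (mult_sum ?Q x (carrier ?Q) H)" using ab b(1) x by simp
    qed
    ultimately show ?thesis
      using Cons.IH[OF Q.sub_mult_sum[OF x Q.carrier_is_submodule H]] x by simp
  qed simp
qed

lemma regular_sequence_quot_module:
  assumes K: "sub K"
  shows "regular_sequence R (quot_module N K) xs \<longleftrightarrow> regular_seq R N (carrier N) xs K"
proof -
  interpret Q: module_over R "quot_module N K"
    using module_quot_module[OF K] by (simp add: module_over_def)
  have "{u \<in> carrier N. K +>\<^bsub>N\<^esub> u \<in> {\<zero>\<^bsub>quot_module N K\<^esub>}} = K"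
    using coset_eq_self_iff[OF K] sub_carrier[OF K] by (auto simp: quot_module_zero)
  then show ?thesis
    using Q.regular_sequence_iff regular_seq_quot_module[OF K Q.sub_singleton_zero] by simp
qed

lemma annihilator_quot_module:
  assumes K: "sub K" shows "annihilator R (quot_module N K) = colon R N K (carrier N)"
  unfolding annihilator_def colon_def
  by (simp add: quot_module_carrier quot_module_zero quot_module_smult[OF K]
      coset_eq_self_iff[OF K] cong: conj_cong)

lemma module_over_restrict: "sub A \<Longrightarrow> module_over R (N\<lparr>carrier := A\<rparr>)"
  unfolding module_over_def using submodule.submodule_is_module module_axioms by blast

lemma submodule_restrict:
  assumes "sub A" "sub B" "B \<subseteq> A" shows "submodule B R (N\<lparr>carrier := A\<rparr>)"
proof -
  interpret A: module_over R "N\<lparr>carrier := A\<rparr>" using assms(1) by (rule module_over_restrict)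
  show ?thesis
    by (rule A.subI) (use assms sub_zero sub_add sub_smult in auto)
qed

lemma subquotient:
  assumes A: "sub A" and B: "sub B" and BA: "B \<subseteq> A"
  shows "regular_sequence R (quot_module (N\<lparr>carrier := A\<rparr>) B) xs \<longleftrightarrow> regular_seq R N A xs B"
    and "zero_module (quot_module (N\<lparr>carrier := A\<rparr>) B) \<longleftrightarrow> A = B"
    and "module_dim R (quot_module (N\<lparr>carrier := A\<rparr>) B) = krull_dim (R Quot colon R N B A)"
proof -
  interpret A: module_over R "N\<lparr>carrier := A\<rparr>" using A by (rule module_over_restrict)
  have B': "A.sub B" using assms by (rule submodule_restrict)
  show "regular_sequence R (quot_module (N\<lparr>carrier := A\<rparr>) B) xs \<longleftrightarrow> regular_seq R N A xs B"
    using A.regular_sequence_quot_module[OF B'] by (simp add: regular_seq_restrict)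
  show "zero_module (quot_module (N\<lparr>carrier := A\<rparr>) B) \<longleftrightarrow> A = B"
    using A.zero_module_quot_module[OF B'] by simp
  show "module_dim R (quot_module (N\<lparr>carrier := A\<rparr>) B) = krull_dim (R Quot colon R N B A)"
    using A.annihilator_quot_module[OF B'] by (simp add: module_dim_def colon_def)
qed

text \<open>A prime containing all the products contains \<open>I\<close> or \<open>J\<close>, so
  every chain above \<open>L\<close> is a chain above one of them. Applied to annihilators, this
  bounds the dimension of sums and of extensions.\<close>

lemma krull_dim_quot_le_of_product:
  assumes I: "ideal I R" and J: "ideal J R" and L: "ideal L R"
    and prod: "\<And>r s. r \<in> I \<Longrightarrow> s \<in> J \<Longrightarrow> r \<otimes> s \<in> L"
    and dim: "krull_dim (R Quot I) \<le> c" "krull_dim (R Quot J) \<le> c"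
  shows "krull_dim (R Quot L) \<le> c"
  unfolding R.krull_dim_quot_le_iff[OF L]
proof (intro allI impI)
  fix n A B assume LA: "L \<subseteq> A" and chain: "prime_chain R n A B"
  interpret A: primeideal A R using prime_chain_primes[OF chain] by blast
  have "I \<subseteq> A \<or> J \<subseteq> A"
  proof (rule ccontr)
    assume "\<not> (I \<subseteq> A \<or> J \<subseteq> A)"
    then obtain r s where rs: "r \<in> I" "r \<notin> A" "s \<in> J" "s \<notin> A" by blast
    then have "r \<in> carrier R" "s \<in> carrier R" using ideal.Icarr[OF I rs(1)] ideal.Icarr[OF J rs(3)] by auto
    then show False using A.I_prime prod[OF rs(1,3)] LA rs by blast
  qed
  then show "ereal (real n) \<le> c"
    using dim chain R.krull_dim_quot_le_iff[OF I] R.krull_dim_quot_le_iff[OF J] by blast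
qed

lemma colon_carrier:
  assumes "A \<subseteq> carrier N" shows "colon R N B A = carrier R \<Longrightarrow> A \<subseteq> B"
proof
  fix u assume "colon R N B A = carrier R" "u \<in> A"
  then have "\<one> \<odot>\<^bsub>N\<^esub> u \<in> B" using R.one_closed by (metis colon_iff)
  then show "u \<in> B" using assms \<open>u \<in> A\<close> by auto
qed

end

section \<open>The dimension filtration\<close>

context noetherian_local_module
begin

abbreviation "Z \<equiv> {\<zero>\<^bsub>N\<^esub>}"

abbreviation "dim_sub H \<equiv> krull_dim (R Quot colon R N Z H)"

lemma ideal_annihilator: "sub H \<Longrightarrow> ideal (colon R N Z H) R"
  by (intro ideal_colon sub_singleton_zero submoduleE(1))

lemma module_dim_restrict: "module_dim R (N\<lparr>carrier := H\<rparr>) = dim_sub H"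
  by (simp add: module_dim_def annihilator_def colon_def)

lemma module_dim_eq: "module_dim R N = dim_sub (carrier N)"
  by (simp add: module_dim_def annihilator_def colon_def)

lemma mem_Ass_iff: "P \<in> Ass R N \<longleftrightarrow> primeideal P R \<and> (\<exists>u\<in>carrier N. P = colon R N Z {u})"
  by (simp add: Ass_def colon_def)

text \<open>A maximal annihilator for \<open>H\<close> is a prime of \<open>Ass R N\<close>. Since
  it contains the annihilator of \<open>H\<close>, the dimension of \<open>H\<close> is at least
  \<open>indim R N\<close>.\<close>

lemma exists_Ass_above:
  assumes H: "sub H" "H \<noteq> Z"
  shows "\<exists>P\<in>Ass R N. colon R N Z H \<subseteq> P"
proof -
  obtain u where u: "u \<in> H" "u \<notin> Z" using H sub_zero by blast
  obtain P where P: "P \<in> maximal_annihilators H Z" "colon R N Z {u} \<subseteq> P"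
    using maximal_annihilator_above[OF H(1) sub_singleton_zero u] by blast
  have "primeideal P R" using maximal_annihilator_prime[OF H(1) sub_singleton_zero P(1)] .
  moreover obtain v where "v \<in> H" "P = colon R N Z {v}"
    using P(1) by (auto simp: maximal_annihilators_def)
  ultimately have "P \<in> Ass R N" using sub_carrier[OF H(1)] by (auto simp: mem_Ass_iff)
  moreover have "colon R N Z H \<subseteq> colon R N Z {u}" using u(1) by (auto simp: colon_iff)
  ultimately show ?thesis using P(2) by blast
qed

lemma krull_dim_quot_antimono:
  assumes "ideal I R" "ideal J R" "I \<subseteq> J"
  shows "krull_dim (R Quot J) \<le> krull_dim (R Quot I)"
  unfolding R.krull_dim_quot_le_iff[OF assms(2)]
  using R.krull_dim_quot_ge[OF assms(1)] assms(3) by (meson subset_trans)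

lemma depth_ge_zero_module: "sub A \<Longrightarrow> depth_ge n A A"
proof (induction n)
  case (Suc n)
  obtain x where x: "x \<in> M"
    using additive_subgroup.zero_closed[OF ideal.axioms(1)[OF maximalideal.axioms(1)[OF maximal]]]
    by blast
  note xR = maximal_subset_carrier[OF x]
  have "mult_sum N x A A = A"
    using mult_sum_upper(1)[OF xR Suc.prems Suc.prems] mult_sum_subset[OF xR Suc.prems] by auto
  with Suc x show ?case by (auto simp: regular_on_def intro!: bexI[of _ x])
qed simp

lemma depth_ge_Suc_imp: "depth_ge (Suc n) A B \<Longrightarrow> depth_ge n A B"
proof (induction n arbitrary: B)
  case (Suc n)
  then obtain x where "x \<in> M" "regular_on N x A B" "depth_ge (Suc n) A (mult_sum N x A B)"
    by auto
  with Suc.IH show ?case by auto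
qed simp

lemma depth_ge_mono: "depth_ge n A B \<Longrightarrow> m \<le> n \<Longrightarrow> depth_ge m A B"
proof (induction n)
  case (Suc n)
  then show ?case using depth_ge_Suc_imp by (cases "m = Suc n") auto
qed simp

lemma regular_seq_imp_depth_ge:
  "set xs \<subseteq> M \<Longrightarrow> regular_seq R N A xs B \<Longrightarrow> depth_ge (length xs) A B"
  by (induction xs arbitrary: B) auto

text \<open>\<open>depth_ge\<close> does not ask for a nonzero final quotient; Nakayama shows that
  dividing by an element of \<open>M\<close> never exhausts a nonzero \<open>A / B\<close>.\<close>

lemma depth_ge_imp_regular_seq:
  assumes A: "sub A"
  shows "\<lbrakk>sub B; B \<subseteq> A; A \<noteq> B; depth_ge n A B\<rbrakk>
    \<Longrightarrow> \<exists>xs. set xs \<subseteq> M \<and> length xs = n \<and> regular_seq R N A xs B"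
proof (induction n arbitrary: B)
  case 0 then show ?case by (intro exI[of _ "[]"]) auto
next
  case (Suc n)
  obtain x where x: "x \<in> M" "regular_on N x A B" "depth_ge n A (mult_sum N x A B)"
    using Suc.prems(4) by auto
  note xR = maximal_subset_carrier[OF x(1)]
  have "A \<noteq> mult_sum N x A B" using nakayama[OF x(1) A Suc.prems(1)] Suc.prems(2,3) by auto
  then obtain xs where "set xs \<subseteq> M" "length xs = n" "regular_seq R N A xs (mult_sum N x A B)"
    using Suc.IH[OF sub_mult_sum[OF xR A Suc.prems(1)] mult_sum_subset[OF xR A Suc.prems(2)]] x(3)
    by blast
  with x xR show ?case by (intro exI[of _ "x # xs"]) auto
qed

lemma depth_subquotient:
  assumes "sub A" "sub B" "B \<subseteq> A" "A \<noteq> B"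
  shows "depth R M (quot_module (N\<lparr>carrier := A\<rparr>) B) =
    (SUP xs\<in>{xs. set xs \<subseteq> M \<and> regular_seq R N A xs B}. ereal (real (length xs)))"
  using subquotient[OF assms(1-3)] assms(4) by (simp add: depth_def)

lemma depth_eq:
  assumes "carrier N \<noteq> Z"
  shows "depth R M N =
    (SUP xs\<in>{xs. set xs \<subseteq> M \<and> regular_seq R N (carrier N) xs Z}. ereal (real (length xs)))"
  using assms by (simp add: depth_def zero_module_def regular_sequence_iff)

text \<open>\<open>GREATEST\<close> is meaningful only if a greatest submodule exists. A maximal
  \<open>H\<close> exists by the Noetherian property, and it absorbs every competitor
  \<open>K\<close>, because the product of the two annihilators kills \<open>H + K\<close> and hence
  the sum still has dimension at most \<open>i\<close>.\<close>

lemma dim_filtration_props: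
  shows "sub (dim_filtration R N i)"
    and "dim_sub (dim_filtration R N i) \<le> ereal (real_of_int i)"
    and "\<And>H. sub H \<Longrightarrow> dim_sub H \<le> ereal (real_of_int i) \<Longrightarrow> H \<subseteq> dim_filtration R N i"
proof -
  let ?P = "\<lambda>H. sub H \<and> module_dim R (N\<lparr>carrier := H\<rparr>) \<le> ereal (real_of_int i)"
  \<comment> \<open>The zero submodule qualifies even for negative \<open>i\<close>: its annihilator
    is \<open>R\<close>, above which there is no prime, so its dimension is
    \<open>-\<infinity>\<close>.\<close>
  have Pz: "?P Z"
  proof -
    have "colon R N Z Z = carrier R" by (auto simp: colon_iff)
    then have "dim_sub Z \<le> ereal (real_of_int i)"
      unfolding R.krull_dim_quot_le_iff[OF ideal_annihilator[OF sub_singleton_zero]]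
      using prime_chain_primes primeideal.I_notcarr ideal.axioms(1) additive_subgroup.a_subset
        primeideal.axioms(1) by (metis subset_antisym)
    then show ?thesis using sub_singleton_zero by (simp add: module_dim_restrict)
  qed
  have "\<exists>H\<in>Collect ?P. \<forall>K\<in>Collect ?P. H \<subseteq> K \<longrightarrow> K = H"
    using Pz by (intro maximal_submodule_exists) auto
  then obtain H where H: "H \<in> Collect ?P" and max: "\<forall>K\<in>Collect ?P. H \<subseteq> K \<longrightarrow> K = H"
    by (rule bexE) (rule that)
  have sH: "sub H" and dH: "dim_sub H \<le> ereal (real_of_int i)" using H by (simp_all add: module_dim_restrict)
  have le: "K \<subseteq> H" if K: "?P K" for K
  proof -
    have sK: "sub K" and dK: "dim_sub K \<le> ereal (real_of_int i)"
      using K by (simp_all add: module_dim_restrict)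
    have sHK: "sub (H <+>\<^bsub>N\<^esub> K)" using sH sK by (rule sub_set_add)
    have "dim_sub (H <+>\<^bsub>N\<^esub> K) \<le> ereal (real_of_int i)"
    proof (rule krull_dim_quot_le_of_product[OF ideal_annihilator[OF sH] ideal_annihilator[OF sK]
          ideal_annihilator[OF sHK] _ dH dK])
      fix r s assume rs: "r \<in> colon R N Z H" "s \<in> colon R N Z K"
      show "r \<otimes> s \<in> colon R N Z (H <+>\<^bsub>N\<^esub> K)"
        unfolding colon_iff
      proof (intro conjI ballI)
        show "r \<otimes> s \<in> carrier R" using rs by (simp add: colon_iff)
        fix u assume "u \<in> H <+>\<^bsub>N\<^esub> K"
        then obtain h k where hk: "h \<in> H" "k \<in> K" "u = h \<oplus>\<^bsub>N\<^esub> k" by (auto simp: set_add_iff)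
        have N: "h \<in> carrier N" "k \<in> carrier N" using hk sub_carrier[OF sH] sub_carrier[OF sK] by auto
        have "r \<in> carrier R" "s \<in> carrier R" "r \<odot>\<^bsub>N\<^esub> h = \<zero>\<^bsub>N\<^esub>" "s \<odot>\<^bsub>N\<^esub> k = \<zero>\<^bsub>N\<^esub>"
          using rs hk by (simp_all add: colon_iff)
        then show "(r \<otimes> s) \<odot>\<^bsub>N\<^esub> u \<in> Z"
          using hk(3) N by (simp add: smult_assoc1 smult_r_distr smult_comm[of r s h])
      qed
    qed
    then have "H <+>\<^bsub>N\<^esub> K = H"
      using bspec[OF max, of "H <+>\<^bsub>N\<^esub> K"] sHK set_add_upper[OF sH sK] by (simp add: module_dim_restrict)
    then show ?thesis using set_add_upper[OF sH sK] by simp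
  qed
  have eq: "dim_filtration R N i = H"
    unfolding dim_filtration_def using H le by (intro Greatest_equality) auto
  show "sub (dim_filtration R N i)" "dim_sub (dim_filtration R N i) \<le> ereal (real_of_int i)"
    using sH dH by (simp_all add: eq)
  show "K \<subseteq> dim_filtration R N i" if "sub K" "dim_sub K \<le> ereal (real_of_int i)" for K
    using le[of K] that by (simp add: eq module_dim_restrict)
qed

lemma colon_nontrivial:
  assumes "sub A" "sub B" "\<not> A \<subseteq> B" shows "colon R N B A \<noteq> carrier R"
  using colon_carrier[OF submoduleE(1)[OF assms(1)]] assms(3) by blast

text \<open>The dimensions that occur are natural numbers, so the infimum over the nonempty set of
  associated primes is a minimum. The prime attaining it later shows that \<open>indim R N\<close>
  is at most \<open>dim N\<close>.\<close>

lemma indim_attained: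
  assumes "carrier N \<noteq> Z"
  obtains d P where "indim R N = ereal (real d)" "P \<in> Ass R N" "krull_dim (R Quot P) = ereal (real d)"
proof -
  let ?D = "\<lambda>n. \<exists>P\<in>Ass R N. krull_dim (R Quot P) = ereal (real n)"
  have nat: "\<exists>n. krull_dim (R Quot P) = ereal (real n)" if P: "P \<in> Ass R N" for P
  proof -
    interpret P: primeideal P R using P by (simp add: mem_Ass_iff)
    show ?thesis using krull_dim_quot_nat[OF P.is_ideal] P.I_notcarr by metis
  qed
  obtain P where "P \<in> Ass R N" using exists_Ass_above[OF carrier_is_submodule assms] by blast
  with nat have "\<exists>n. ?D n" by blast
  then obtain d where d: "?D d" and least: "\<And>n. ?D n \<Longrightarrow> d \<le> n"
    using exists_least_iff[of ?D] by (metis not_le)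
  then obtain P where P: "P \<in> Ass R N" "krull_dim (R Quot P) = ereal (real d)" by blast
  have "indim R N = ereal (real d)"
    unfolding indim_def
  proof (rule antisym)
    show "(INF P\<in>Ass R N. krull_dim (R Quot P)) \<le> ereal (real d)"
      using INF_lower[OF P(1), of "\<lambda>P. krull_dim (R Quot P)"] P(2) by simp
    show "ereal (real d) \<le> (INF P\<in>Ass R N. krull_dim (R Quot P))"
    proof (rule INF_greatest)
      fix Q assume Q: "Q \<in> Ass R N"
      then obtain n where "krull_dim (R Quot Q) = ereal (real n)" using nat by blast
      with least Q show "ereal (real d) \<le> krull_dim (R Quot Q)" by force
    qed
  qed
  then show ?thesis using that P by blast
qed

lemma depth_le_indim:
  assumes "carrier N \<noteq> Z" shows "depth R M N \<le> indim R N"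
  unfolding depth_eq[OF assms] indim_def
proof (intro SUP_least INF_greatest)
  fix xs P assume "xs \<in> {xs. set xs \<subseteq> M \<and> regular_seq R N (carrier N) xs Z}" and P: "P \<in> Ass R N"
  then have ge: "depth_ge (length xs) (carrier N) Z" using regular_seq_imp_depth_ge by simp
  obtain u where u: "primeideal P R" "u \<in> carrier N" "P = colon R N Z {u}"
    using P by (auto simp: mem_Ass_iff)
  obtain Q where "prime_chain R (length xs) P Q"
    using depth_ge_prime_chain[OF carrier_is_submodule sub_singleton_zero _ _ _ ge] u by auto
  then show "ereal (real (length xs)) \<le> krull_dim (R Quot P)"
    using R.krull_dim_quot_ge[OF primeideal.axioms(1)[OF u(1)] subset_refl] by blast
qed

text \<open>The index starts one below \<open>d\<close> so that the base case is the zero submodule;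
  each step is an extension of a Cohen--Macaulay quotient by the previous term. The bound by
  \<open>module_dim R N\<close> keeps every index within the range of the hypothesis.\<close>

lemma depth_ge_dim_filtration:
  assumes seq: "sequentially_cohen_macaulay R M N"
    and d: "indim R N = ereal (real d)"
  shows "ereal (real_of_int (int d - 1 + int j)) \<le> module_dim R N
    \<Longrightarrow> depth_ge d (dim_filtration R N (int d - 1 + int j)) Z"
proof (induction j)
  let ?D = "dim_filtration R N"
  case 0
  have "?D (int d - 1) = Z"
  proof (rule ccontr)
    assume "?D (int d - 1) \<noteq> Z"
    then obtain P where P: "P \<in> Ass R N" "colon R N Z (?D (int d - 1)) \<subseteq> P"
      using exists_Ass_above[OF dim_filtration_props(1)] by blast
    then have "primeideal P R" by (simp add: mem_Ass_iff)
    have "ereal (real d) \<le> krull_dim (R Quot P)" using d P(1) by (metis INF_lower indim_def)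
    also have "\<dots> \<le> dim_sub (?D (int d - 1))"
      using P(2) \<open>primeideal P R\<close>
      by (intro krull_dim_quot_antimono ideal_annihilator dim_filtration_props(1) primeideal.axioms)
    also have "\<dots> \<le> ereal (real_of_int (int d - 1))" by (rule dim_filtration_props(2))
    finally show False by simp
  qed
  then show ?case using depth_ge_zero_module[OF sub_singleton_zero] by simp
next
  let ?D = "dim_filtration R N"
  case (Suc j)
  define i where "i = int d + int j"
  have i: "int d - 1 + int (Suc j) = i" "int d - 1 + int j = i - 1" "int d \<le> i" by (simp_all add: i_def)
  let ?A = "?D i" and ?B = "?D (i - 1)"
  have idim: "ereal (real_of_int i) \<le> module_dim R N" using Suc.prems unfolding i(1) .
  have "ereal (real_of_int (i - 1)) \<le> ereal (real_of_int i)" by simp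
  then have "ereal (real_of_int (i - 1)) \<le> module_dim R N" using idim by (rule order_trans)
  then have IH: "depth_ge d ?B Z" using Suc.IH unfolding i(2) by blast
  note A = dim_filtration_props(1)[of i] and B = dim_filtration_props(1)[of "i - 1"]
  have "dim_sub ?B \<le> ereal (real_of_int i)"
    using dim_filtration_props(2)[of "i - 1"] by (rule order_trans) simp
  then have BA: "?B \<subseteq> ?A" by (rule dim_filtration_props(3)[OF B])
  have "depth_ge d ?A ?B \<or> ?A = ?B"
  proof (cases "?A = ?B")
    case False
    let ?I = "colon R N ?B ?A"
    have I: "ideal ?I R" using B submoduleE(1)[OF A] by (rule ideal_colon)
    obtain e where e: "krull_dim (R Quot ?I) = ereal (real e)"
      using krull_dim_quot_nat[OF I] colon_nontrivial[OF A B] False BA by blast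
    have "ereal (real d) \<le> ereal (real_of_int i)" using i(3) by simp
    then have "cohen_macaulay R M (quot_module (N\<lparr>carrier := ?A\<rparr>) ?B)"
      using seq d idim unfolding sequentially_cohen_macaulay_def by simp
    then have depth: "(SUP xs\<in>{xs. set xs \<subseteq> M \<and> regular_seq R N ?A xs ?B}. ereal (real (length xs)))
        = ereal (real e)"
      using subquotient(2,3)[OF A B BA] depth_subquotient[OF A B BA False] False e
      by (simp add: cohen_macaulay_def)
    have "i \<le> int e"
    proof (rule ccontr)
      assume "\<not> i \<le> int e"
      then have "krull_dim (R Quot ?I) \<le> ereal (real_of_int (i - 1))" by (simp add: e)
      then have "dim_sub ?A \<le> ereal (real_of_int (i - 1))"
      proof (rule krull_dim_quot_le_of_product[OF I ideal_annihilator[OF B] ideal_annihilator[OF A],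
            rotated])
        show "dim_sub ?B \<le> ereal (real_of_int (i - 1))" by (rule dim_filtration_props(2))
        fix r s assume rs: "r \<in> ?I" "s \<in> colon R N Z ?B"
        show "r \<otimes> s \<in> colon R N Z ?A"
          unfolding colon_iff
        proof (intro conjI ballI)
          show "r \<otimes> s \<in> carrier R" using rs by (simp add: colon_iff)
          fix u assume u: "u \<in> ?A"
          have "r \<in> carrier R" "s \<in> carrier R" "r \<odot>\<^bsub>N\<^esub> u \<in> ?B" "u \<in> carrier N"
            using rs u sub_carrier[OF A u] by (simp_all add: colon_iff)
          moreover from this have "s \<odot>\<^bsub>N\<^esub> (r \<odot>\<^bsub>N\<^esub> u) = \<zero>\<^bsub>N\<^esub>" using rs(2) by (simp add: colon_iff)
          ultimately show "(r \<otimes> s) \<odot>\<^bsub>N\<^esub> u \<in> Z" by (simp add: smult_assoc1 smult_comm[of r s u])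
        qed
      qed
      then have "?A \<subseteq> ?B" by (rule dim_filtration_props(3)[OF A])
      with BA False show False by blast
    qed
    then have de: "d \<le> e" using i(3) by linarith
    have "depth_ge d ?A ?B"
    \<comment> \<open>Depth is a supremum: were all lengths at most \<open>d - 1\<close>, so would
      \<open>e\<close> be. The case \<open>d = 0\<close> is set apart because \<open>d - 1\<close>
      is truncated there.\<close>
    proof (cases "d = 0")
      case dpos: False
      have "\<exists>xs. set xs \<subseteq> M \<and> regular_seq R N ?A xs ?B \<and> d \<le> length xs"
      proof (rule ccontr)
        assume "\<nexists>xs. set xs \<subseteq> M \<and> regular_seq R N ?A xs ?B \<and> d \<le> length xs"
        then have "ereal (real (length xs)) \<le> ereal (real (d - 1))"
          if "xs \<in> {xs. set xs \<subseteq> M \<and> regular_seq R N ?A xs ?B}" for xs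
          using that by force
        then have "ereal (real e) \<le> ereal (real (d - 1))" unfolding depth[symmetric] by (rule SUP_least)
        with de dpos show False by simp
      qed
      then show ?thesis using regular_seq_imp_depth_ge depth_ge_mono by blast
    qed simp
    then show ?thesis ..
  qed simp
  then show ?case
    unfolding i(1) using depth_ge_extension[OF A B sub_singleton_zero _ BA IH] IH sub_zero[OF B] by auto
qed

lemma indim_le_depth:
  assumes nz: "carrier N \<noteq> Z" and seq: "sequentially_cohen_macaulay R M N"
  shows "indim R N \<le> depth R M N"
proof -
  obtain d P where d: "indim R N = ereal (real d)" "P \<in> Ass R N" "krull_dim (R Quot P) = ereal (real d)"
    using indim_attained[OF nz] .
  note C = carrier_is_submodule
  have nsub: "\<not> carrier N \<subseteq> Z" using nz by blast
  obtain e where e: "module_dim R N = ereal (real e)"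
    using krull_dim_quot_nat[OF ideal_annihilator[OF C] colon_nontrivial[OF C sub_singleton_zero nsub]]
    by (metis module_dim_eq)
  obtain u where "u \<in> carrier N" "P = colon R N Z {u}" "primeideal P R"
    using d(2) by (auto simp: mem_Ass_iff)
  then have "colon R N Z (carrier N) \<subseteq> P" by (auto simp: colon_iff)
  then have "krull_dim (R Quot P) \<le> dim_sub (carrier N)"
    using \<open>primeideal P R\<close> by (intro krull_dim_quot_antimono ideal_annihilator C primeideal.axioms)
  then have "d \<le> e" using d(3) e by (simp add: module_dim_eq)
  \<comment> \<open>The ascent from \<open>d - 1\<close> to \<open>e = dim N\<close> takes
    \<open>e - d + 1\<close> steps, and \<open>N_e\<close> is all of \<open>N\<close>.\<close>
  define j where "j = Suc (e - d)"
  have j: "int d - 1 + int j = int e" using \<open>d \<le> e\<close> by (simp add: j_def)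
  have "depth_ge d (dim_filtration R N (int e)) Z"
    using depth_ge_dim_filtration[OF seq d(1), of j] e by (simp add: j)
  moreover have "carrier N \<subseteq> dim_filtration R N (int e)"
    using e by (intro dim_filtration_props(3) C) (simp add: module_dim_eq)
  then have "dim_filtration R N (int e) = carrier N"
    using sub_carrier[OF dim_filtration_props(1)] by blast
  ultimately have "depth_ge d (carrier N) Z" by simp
  then obtain xs where "set xs \<subseteq> M" "length xs = d" "regular_seq R N (carrier N) xs Z"
    using depth_ge_imp_regular_seq[OF C sub_singleton_zero _ nz] by auto
  then show ?thesis
    unfolding depth_eq[OF nz] d(1) by (intro SUP_upper2[of xs]) auto
qed

end

theorem corollary3p27:
  fixes R :: "('a, 'r) ring_scheme" and M :: "'a set"
    and N :: "('a, 'b, 'm) module_scheme"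
  assumes "noetherian_ring R"
    and "local_ring R M"
    and "module R N"
    and "fin_gen_module R N"
    and "sequentially_cohen_macaulay R M N"
  shows "initially_cohen_macaulay R M N"
proof -
  interpret module_over R N using assms(3) by (simp add: module_over_def)
  interpret noetherian_local_module R N M
    using noetherian_module_fin_gen[OF assms(1,4)] assms(1,2)
    by (simp add: noetherian_local_module_def noetherian_local_ring_def)
  show ?thesis
    unfolding initially_cohen_macaulay_def zero_module_def
    using depth_le_indim indim_le_depth assms(5) by (metis antisym)
qed

end
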